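(* Let $X$ be a real Banach space and $\bar{x}\in\Omega$. Assume that for each $j\in J$: (i) the set $\mathcal{V}_j^{\varepsilon_j}(\bar{x})$ is compact for some $\varepsilon_j>0$; (ii) for each $x$ around $\bar{x}$ the function $g_j(x,\cdot)$ is upper semicontinuous on $\mathcal{V}_j^{\varepsilon_j}(\bar{x})$, and $g_j(\cdot,v_j)$ is locally Lipschitz at $\bar{x}$ uniformly in $v_j\in\mathcal{V}_j$ with modulus $L_j>0$; (iii) the set-valued mapping $\partial_x^C g_j$ is weak$^*$ closed at $(\bar{x},\bar{v}_j)$ for each $\bar{v}_j\in\mathcal{V}_j(\bar{x})$. Let the functions $f_i$ be locally Lipschitz at $\bar{x}$ for each $i\in I$. If $\bar{x}$ is a local highly robust weakly efficient solution of $(P_{\mathcal{U}})$, then for each $u\in\mathcal{U}$ there exist $\lambda_i\ge0$, $i\in I$, and $\mu_j\ge0$, $j\in J$, with $\sum_{i=1}^p\lambda_i+\sum_{j=1}^q\mu_j=1$, such that $$\sum_{i=1}^p\lambda_iu_i\in\sum_{i=1}^p\lambda_i\partial^C f_i(\bar{x})+\sum_{j=1}^q\mu_j\,\mathrm{cl}^*\mathrm{co}\Big(\bigcup_{v_j\in\mathcal{V}_j(\bar{x})}\partial_x^C g_j(\bar{x},v_j)\Big),$$ $$\mu_j\sup_{v_j\in\mathcal{V}_j}g_j(\bar{x},v_j)=0\quad\text{for all } j\in J.$$ In addition, if $$0\notin\mathrm{cl}^*\mathrm{co}\Big(\bigcup_{j\in J}\bigcup_{v_j\in\mathcal{V}_j(\bar{x})}\partial_x^C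 g_j(\bar{x},v_j)\Big),$$ then the $\lambda_i$, $i\in I$, are not all zero.
   Context: Setting: $X$ has dual $X^*$ and pairing $\langle\cdot,\cdot\rangle$; $p\ge 2$, $I=\{1,\dots,p\}$, $J=\{1,\dots,q\}$; $f=(f_1,\dots,f_p):X\to\mathbb{R}^p$; $\mathcal{U}_i\subseteq X^*$ nonempty, $\mathcal{U}=\prod_{i=1}^p\mathcal{U}_i$; each $\mathcal{V}_j$ is a nonempty set with a Hausdorff topology and $g_j:X\times\mathcal{V}_j\to[-\infty,\infty]$ is proper (never $-\infty$, not identically $+\infty$). The robust feasible set is $\Omega=\{x\in X: g_j(x,v_j)\le0\ \forall v_j\in\mathcal{V}_j,\ \forall j\in J\}$. For $u\in\mathcal{U}$, $f_i(x,u_i)=f_i(x)-\langle u_i,x\rangle$, $f(x,u)=(f_1(x,u_1),\dots,f_p(x,u_p))$; $(P_u)$ is: minimize $f(x,u)$ over $x\in\Omega$; $(P_{\mathcal{U}})$ is the family $(P_u)_{u\in\mathcal{U}}$. For $a,b\in\mathbb{R}^p$, $a<b$ iff $a_i<b_i$ for all $i$. $\bar x\in\Omega$ is a local highly robust weakly efficient solution of $(P_{\mathcal{U}})$ if there is a neighbourhood $\mathcal{B}$ of $\bar x$ such that for every $u\in\mathcal{U}$ there is no $x\in\Omega\cap\mathcal{B}$ with $f(x,u)<f(\bar x,u)$. $G_j(x)=\sup_{v_j\in\mathcal{V}_j}g_j(x,v_j)$; $\mathcal{V}_j^{\varepsilon}(\bar x)=\{v_j\in\mathcal{V}_j:g_j(\bar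 x,v_j)\ge G_j(\bar x)-\varepsilon\}$ for $\varepsilon\ge0$; $\mathcal{V}_j(\bar x)=\mathcal{V}_j^0(\bar x)$. Uniform local Lipschitz property in (ii): there is a neighbourhood $\mathcal{B}$ of $\bar x$ with $|g_j(x,v_j)-g_j(y,v_j)|\le L_j\Vert x-y\Vert$ for all $x,y\in\mathcal{B}$, $v_j\in\mathcal{V}_j$. Locally Lipschitz at $\bar x$ means Lipschitz on a neighbourhood of $\bar x$. Clarke subdifferential: $\partial^C\varphi(\bar x)=\{x^*\in X^*:\langle x^*,d\rangle\le\varphi^\circ(\bar x;d)\ \forall d\in X\}$, $\varphi^\circ(\bar x;d)=\limsup_{x\to\bar x,\,t\downarrow0}\frac{\varphi(x+td)-\varphi(x)}{t}$; $\partial_x^Cg_j(x,v_j)$ is the Clarke subdifferential of $g_j(\cdot,v_j)$ at $x$. $\partial_x^Cg_j:X\times\mathcal{V}_j\rightrightarrows X^*$ is weak$^*$ closed at $(\bar x,\bar v_j)$ if whenever nets $(x_\nu,v_\nu)\to(\bar x,\bar v_j)$ and $x_\nu^*\in\partial_x^Cg_j(x_\nu,v_\nu)$ with $x_\nu^*\to x^*$ weak$^*$, then $x^*\in\partial_x^Cg_j(\bar x,\bar v_j)$. $\mathrm{co}$ is convex hull, $\mathrm{cl}^*$ is weak$^*$ closure in $X^*$. *)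

theory Defs
  imports "HOL-Analysis.Analysis"
begin

(* The dual of X is 'a \<Rightarrow>\<^sub>L real, with pairing blinfun_apply. For real-valued operators the strong
   operator topology is the topology of pointwise convergence on X, i.e. the weak* topology. *)
abbreviation weak_star :: "('a::real_normed_vector \<Rightarrow>\<^sub>L real) topology" where
  "weak_star \<equiv> strong_operator_topology"

(* Each uncertainty set is the carrier of an abstract topology T j on a common type 'v; distinct
   sets, with unrelated topologies, embed in such a type as summands of a disjoint union. *)

definition proper_on :: "'v set \<Rightarrow> ('a \<Rightarrow> 'v \<Rightarrow> ereal) \<Rightarrow> bool" where
  "proper_on V h \<longleftrightarrow> (\<forall>x. \<forall>v\<in>V. h x v \<noteq> -\<infinity>) \<and> (\<exists>x. \<exists>v\<in>V. h x v \<noteq> \<infinity>)"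

definition robust_feasible ::
  "nat \<Rightarrow> (nat \<Rightarrow> 'v topology) \<Rightarrow> (nat \<Rightarrow> 'a \<Rightarrow> 'v \<Rightarrow> ereal) \<Rightarrow> 'a set" where
  "robust_feasible q T g = {x. \<forall>j\<in>{1..q}. \<forall>v\<in>topspace (T j). g j x v \<le> 0}"

definition perturbed ::
  "(nat \<Rightarrow> 'a \<Rightarrow> real) \<Rightarrow> (nat \<Rightarrow> 'a \<Rightarrow>\<^sub>L real) \<Rightarrow> nat \<Rightarrow> 'a::real_normed_vector \<Rightarrow> real" where
  "perturbed f u i x = f i x - blinfun_apply (u i) x"

definition local_highly_robust_weakly_efficient ::
  "nat \<Rightarrow> (nat \<Rightarrow> 'a \<Rightarrow> real) \<Rightarrow> (nat \<Rightarrow> ('a \<Rightarrow>\<^sub>L real) set) \<Rightarrow> 'a set \<Rightarrow> 'a::real_normed_vector \<Rightarrow> bool"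
  where
  "local_highly_robust_weakly_efficient p f U \<Omega> xbar \<longleftrightarrow>
     xbar \<in> \<Omega> \<and>
     (\<exists>B. open B \<and> xbar \<in> B \<and>
       (\<forall>u \<in> Pi\<^sub>E {1..p} U.
          \<not> (\<exists>x \<in> \<Omega> \<inter> B. \<forall>i\<in>{1..p}. perturbed f u i x < perturbed f u i xbar)))"

definition sup_fun :: "'v set \<Rightarrow> ('a \<Rightarrow> 'v \<Rightarrow> ereal) \<Rightarrow> 'a \<Rightarrow> ereal" where
  "sup_fun V h x = (SUP v\<in>V. h x v)"

definition active_set :: "'v set \<Rightarrow> ('a \<Rightarrow> 'v \<Rightarrow> ereal) \<Rightarrow> real \<Rightarrow> 'a \<Rightarrow> 'v set" where
  "active_set V h \<epsilon> x = {v\<in>V. h x v \<ge> sup_fun V h x - ereal \<epsilon>}"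

(* Upper semicontinuity of the restriction of h to S, in the topology induced on S. *)
definition usc_on :: "'v topology \<Rightarrow> 'v set \<Rightarrow> ('v \<Rightarrow> ereal) \<Rightarrow> bool" where
  "usc_on T S h \<longleftrightarrow> (\<forall>\<alpha>. openin (subtopology T S) {v \<in> topspace (subtopology T S). h v < \<alpha>})"

definition locally_lipschitz_at :: "('a::metric_space \<Rightarrow> real) \<Rightarrow> 'a \<Rightarrow> bool" where
  "locally_lipschitz_at \<phi> x \<longleftrightarrow> (\<exists>B L. open B \<and> x \<in> B \<and> L-lipschitz_on B \<phi>)"

(* In ereal, \<bar>\<infinity> - \<infinity>\<bar> = \<infinity>, so the inequality (already for x = y) makes h finite on B. *)
definition unif_locally_lipschitz_at ::
  "'v set \<Rightarrow> ('a::real_normed_vector \<Rightarrow> 'v \<Rightarrow> ereal) \<Rightarrow> real \<Rightarrow> 'a \<Rightarrow> bool" where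
  "unif_locally_lipschitz_at V h L xbar \<longleftrightarrow>
     (\<exists>B. open B \<and> xbar \<in> B \<and>
       (\<forall>x\<in>B. \<forall>y\<in>B. \<forall>v\<in>V. \<bar>h x v - h y v\<bar> \<le> ereal (L * norm (x - y))))"

(* Functions are extended-real-valued so that the same notion covers real objectives (through
   ereal) and the constraints. The limsup is over y \<rightarrow> x, with y = x allowed, and t \<down> 0 jointly.
   The ereal difference quotient is an honest one where \<phi> is finite around x. *)
definition clarke_dir :: "('a::real_normed_vector \<Rightarrow> ereal) \<Rightarrow> 'a \<Rightarrow> 'a \<Rightarrow> ereal" where
  "clarke_dir \<phi> x d =
     Limsup (nhds x \<times>\<^sub>F at_right 0) (\<lambda>(y, t). (\<phi> (y + t *\<^sub>R d) - \<phi> y) / ereal t)"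

definition clarke_subdiff :: "('a::real_normed_vector \<Rightarrow> ereal) \<Rightarrow> 'a \<Rightarrow> ('a \<Rightarrow>\<^sub>L real) set" where
  "clarke_subdiff \<phi> x = {s. \<forall>d. ereal (blinfun_apply s d) \<le> clarke_dir \<phi> x d}"

(* Nets are rendered as limits along an arbitrary proper filter F (for a directed set: the filter of
   its tails). The index type is fixed only because a definition cannot quantify over types; the
   lemma below shows that this covers filters, hence nets, on every index type. *)
definition weak_star_closed_at ::
  "'v topology \<Rightarrow> ('a \<Rightarrow> 'v \<Rightarrow> ('a \<Rightarrow>\<^sub>L real) set) \<Rightarrow> 'a::real_normed_vector \<Rightarrow> 'v \<Rightarrow> bool" where
  "weak_star_closed_at T M x v \<longleftrightarrow>
     (\<forall>(F :: ('a \<times> 'v \<times> ('a \<Rightarrow>\<^sub>L real)) filter) xs vs ss s.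
        F \<noteq> bot \<longrightarrow> (xs \<longlongrightarrow> x) F \<longrightarrow> limitin T vs v F \<longrightarrow>
        (\<forall>\<^sub>F \<nu> in F. vs \<nu> \<in> topspace T \<and> ss \<nu> \<in> M (xs \<nu>) (vs \<nu>)) \<longrightarrow>
        limitin weak_star ss s F \<longrightarrow> s \<in> M x v)"

lemma weak_star_closed_atD:
  fixes F :: "'i filter"
  assumes "weak_star_closed_at T M x v" "F \<noteq> bot" "(xs \<longlongrightarrow> x) F" "limitin T vs v F"
    and "\<forall>\<^sub>F \<nu> in F. vs \<nu> \<in> topspace T \<and> ss \<nu> \<in> M (xs \<nu>) (vs \<nu>)" "limitin weak_star ss s F"
  shows "s \<in> M x v"
proof -
  let ?F = "filtermap (\<lambda>\<nu>. (xs \<nu>, vs \<nu>, ss \<nu>)) F"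
  have "?F \<noteq> bot"
    using assms(2) by (simp add: filtermap_bot_iff)
  moreover have "(fst \<longlongrightarrow> x) ?F"
    using assms(3) by (simp add: filterlim_filtermap)
  moreover have "limitin T (fst \<circ> snd) v ?F" "limitin weak_star (snd \<circ> snd) s ?F"
    using assms(4,6) by (simp_all add: limitin_def eventually_filtermap)
  moreover have "\<forall>\<^sub>F \<nu> in ?F. (fst \<circ> snd) \<nu> \<in> topspace T \<and> (snd \<circ> snd) \<nu> \<in> M (fst \<nu>) ((fst \<circ> snd) \<nu>)"
    using assms(5) by (simp add: eventually_filtermap)
  ultimately show ?thesis
    using assms(1) unfolding weak_star_closed_at_def by blast
qed

definition weak_star_closed_hull :: "('a::real_normed_vector \<Rightarrow>\<^sub>L real) set \<Rightarrow> ('a \<Rightarrow>\<^sub>L real) set" where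
  "weak_star_closed_hull S = weak_star closure_of (convex hull S)"

end

theory Submission
  imports Defs
begin

text \<open>
  Fix a perturbation \<open>u\<close>.  The point \<open>xbar\<close> is weakly efficient for the problem perturbed by \<open>u\<close> in a
  neighbourhood, so no direction \<open>d\<close> can make all the perturbed objectives decrease while keeping the
  ray from \<open>xbar\<close> feasible for small steps.

  Infinitesimally, the objective \<open>i\<close> decreases along \<open>d\<close> as soon as every element of the translated
  Clarke subdifferential \<open>\<partial>f\<^sub>i(xbar) - u\<^sub>i\<close> is negative at \<open>d\<close> (\<open>eventually_perturbed_less\<close>).  An inactive
  constraint, one whose supremum at \<open>xbar\<close> is negative, survives by continuity
  (\<open>inactive_constraint_remains\<close>).  An active constraint survives if every Clarke subgradient at an
  active index is negative at \<open>d\<close> (\<open>active_constraint_descent\<close>): a violation arbitrarily close to \<open>xbar\<close>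
  would, by a mean value theorem and compactness, leave a limiting subgradient at an active index that
  is nonnegative at \<open>d\<close>.  It is here that compactness of the almost active indices, upper semicontinuity, the
  uniform Lipschitz constant and closedness of the subdifferential are used together.

  Consequently, for each direction \<open>d\<close>, one of the finitely many sets \<open>\<partial>f\<^sub>i(xbar) - u\<^sub>i\<close> and
  \<open>C\<^sub>j = cl* co (\<Union>v. \<partial>g\<^sub>j(xbar, v))\<close>, \<open>j\<close> active, contains an element nonnegative at \<open>d\<close>.  All these sets are
  convex and weak* compact, and Gordan's theorem of the alternative
  (\<open>Gordan_alternative_weak_star\<close>) turns this into a convex combination of their elements that is
  equal to \<open>0\<close>.  The weights are the multipliers; inactive constraints get the weight \<open>0\<close>, which is
  complementary slackness.  If all \<open>\<lambda>\<^sub>i\<close> vanished, the same combination would represent \<open>0\<close> in the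
  closed convex hull of all active subdifferentials.

  Two classical theorems carry the functional analysis.  The Hahn--Banach theorem for sublinear
  functionals, obtained from minimal sublinear functionals, shows that the Clarke directional
  derivative is attained on the subdifferential.  Weak* compactness of bounded closed sets reduces the
  separation in Gordan's theorem to a projection in finitely many coordinates.
\<close>

section \<open>The Hahn--Banach theorem for sublinear functionals\<close>

definition sublinear_functional :: "('a::real_vector \<Rightarrow> real) \<Rightarrow> bool" where
  "sublinear_functional p \<longleftrightarrow>
     (\<forall>x y. p (x + y) \<le> p x + p y) \<and> (\<forall>c>0. \<forall>x. p (c *\<^sub>R x) \<le> c * p x)"

lemma sublinear_functionalI:
  assumes "\<And>x y. p (x + y) \<le> p x + p y" "\<And>c x. c > 0 \<Longrightarrow> p (c *\<^sub>R x) \<le> c * p x"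
  shows "sublinear_functional p"
  using assms unfolding sublinear_functional_def by blast

lemma sublinear_add: "sublinear_functional p \<Longrightarrow> p (x + y) \<le> p x + p y"
  unfolding sublinear_functional_def by blast

lemma sublinear_scale_pos:
  assumes "sublinear_functional p" "c > 0"
  shows "p (c *\<^sub>R x) = c * p x"
proof (rule antisym)
  show "p (c *\<^sub>R x) \<le> c * p x"
    using assms unfolding sublinear_functional_def by blast
  have "p (inverse c *\<^sub>R (c *\<^sub>R x)) \<le> inverse c * p (c *\<^sub>R x)"
    using assms unfolding sublinear_functional_def by (metis inverse_positive_iff_positive)
  then show "c * p x \<le> p (c *\<^sub>R x)"
    using \<open>c > 0\<close> by (simp add: field_simps)
qed

lemma sublinear_zero:
  assumes "sublinear_functional p"
  shows "p 0 = 0"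
  using sublinear_scale_pos[OF assms, of 2 0] by simp

lemma sublinear_scale:
  assumes "sublinear_functional p" "c \<ge> 0"
  shows "p (c *\<^sub>R x) = c * p x"
  using sublinear_scale_pos[OF assms(1)] sublinear_zero[OF assms(1)] assms(2)
  by (cases "c = 0") auto

lemma sublinear_neg_le:
  assumes "sublinear_functional p"
  shows "- p (- x) \<le> p x"
  using sublinear_add[OF assms, of x "- x"] sublinear_zero[OF assms] by simp

text \<open>The tilt is the infimal convolution of \<open>p\<close> with the functional \<open>- t d \<mapsto> - t p(d)\<close> on the ray
  through \<open>- d\<close>: a sublinear minorant of \<open>p\<close> whose value at \<open>- d\<close> has been pushed down to \<open>- p d\<close>.
  A pointwise minimal sublinear functional coincides with all its tilts, and this forces
  \<open>p (x + d) = p x + p d\<close>.\<close>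

definition tilt :: "('a::real_vector \<Rightarrow> real) \<Rightarrow> 'a \<Rightarrow> 'a \<Rightarrow> real" where
  "tilt p d x = (INF t\<in>{0..}. p (x + t *\<^sub>R d) - t * p d)"

lemma tilt_bdd_below:
  assumes "sublinear_functional p"
  shows "bdd_below ((\<lambda>t. p (x + t *\<^sub>R d) - t * p d) ` {0..})"
proof (rule bdd_belowI2)
  fix t :: real assume "t \<in> {0..}"
  then have "t * p d = p (x + t *\<^sub>R d + - x)"
    using sublinear_scale[OF assms, of t d] by simp
  also have "\<dots> \<le> p (x + t *\<^sub>R d) + p (- x)"
    by (rule sublinear_add[OF assms])
  finally show "- p (- x) \<le> p (x + t *\<^sub>R d) - t * p d" by simp
qed

lemma tilt_le:
  assumes "sublinear_functional p" "t \<ge> 0"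
  shows "tilt p d x \<le> p (x + t *\<^sub>R d) - t * p d"
  unfolding tilt_def using assms by (intro cINF_lower tilt_bdd_below) auto

lemma tilt_greatest:
  assumes "\<And>t. t \<ge> 0 \<Longrightarrow> b \<le> p (x + t *\<^sub>R d) - t * p d"
  shows "b \<le> tilt p d x"
  unfolding tilt_def using assms by (intro cINF_greatest) auto

lemma tilt_sublinear:
  assumes "sublinear_functional p"
  shows "sublinear_functional (tilt p d)"
proof (rule sublinear_functionalI)
  fix x y
  have "tilt p d (x + y) - tilt p d x \<le> tilt p d y"
  proof (rule tilt_greatest)
    fix t :: real assume t: "t \<ge> 0"
    have "tilt p d (x + y) - (p (y + t *\<^sub>R d) - t * p d) \<le> tilt p d x"
    proof (rule tilt_greatest)
      fix s :: real assume s: "s \<ge> 0"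
      have "tilt p d (x + y) \<le> p ((x + s *\<^sub>R d) + (y + t *\<^sub>R d)) - (s + t) * p d"
        using tilt_le[OF assms, of "s + t" d "x + y"] s t by (simp add: algebra_simps)
      also have "\<dots> \<le> p (x + s *\<^sub>R d) + p (y + t *\<^sub>R d) - (s + t) * p d"
        using sublinear_add[OF assms] by simp
      finally show "tilt p d (x + y) - (p (y + t *\<^sub>R d) - t * p d) \<le> p (x + s *\<^sub>R d) - s * p d"
        by (simp add: algebra_simps)
    qed
    then show "tilt p d (x + y) - tilt p d x \<le> p (y + t *\<^sub>R d) - t * p d" by simp
  qed
  then show "tilt p d (x + y) \<le> tilt p d x + tilt p d y" by simp
next
  fix c :: real and x assume c: "c > 0"
  have "tilt p d (c *\<^sub>R x) / c \<le> tilt p d x"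
  proof (rule tilt_greatest)
    fix t :: real assume t: "t \<ge> 0"
    have "tilt p d (c *\<^sub>R x) \<le> p (c *\<^sub>R (x + t *\<^sub>R d)) - c * t * p d"
      using tilt_le[OF assms, of "c * t" d "c *\<^sub>R x"] c t by (simp add: algebra_simps)
    also have "\<dots> = c * (p (x + t *\<^sub>R d) - t * p d)"
      using sublinear_scale_pos[OF assms c, of "x + t *\<^sub>R d"] by (simp only: right_diff_distrib mult.assoc)
    finally show "tilt p d (c *\<^sub>R x) / c \<le> p (x + t *\<^sub>R d) - t * p d"
      using c by (simp add: field_simps)
  qed
  then show "tilt p d (c *\<^sub>R x) \<le> c * tilt p d x"
    using c by (simp add: field_simps)
qed

lemma tilt_le_self:
  assumes "sublinear_functional p"
  shows "tilt p d x \<le> p x"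
  using tilt_le[OF assms, of 0 d x] by simp

lemma tilt_neg_direction:
  assumes "sublinear_functional p"
  shows "tilt p d (- d) \<le> - p d"
  using tilt_le[OF assms, of 1 d "- d"] sublinear_zero[OF assms] by simp

lemma minimal_sublinear_imp_linear:
  assumes p: "sublinear_functional p"
    and minimal: "\<And>q. sublinear_functional q \<Longrightarrow> (\<And>x. q x \<le> p x) \<Longrightarrow> q = p"
  shows "linear p"
proof -
  have tilt: "tilt p d = p" for d
    by (rule minimal[OF tilt_sublinear[OF p] tilt_le_self[OF p]])
  have add: "p (x + d) = p x + p d" for x d
    using tilt_le[OF p, of 1 d x] sublinear_add[OF p, of x d] by (simp add: tilt)
  have neg: "p (- x) = - p x" for x
    using add[of x "- x"] sublinear_zero[OF p] by simp
  show "linear p"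
  proof (rule linearI[OF add])
    fix c :: real and x
    show "p (c *\<^sub>R x) = c *\<^sub>R p x"
    proof (cases "c \<ge> 0")
      case False
      then show ?thesis
        using sublinear_scale[OF p, of "- c" x] neg[of "c *\<^sub>R x"] by simp
    qed (use sublinear_scale[OF p] in simp)
  qed
qed

text \<open>Zorn's lemma: the pointwise infimum of a chain of sublinear functionals is again sublinear, and it
  is finite because every sublinear \<open>q \<le> p\<close> satisfies \<open>q x \<ge> - p (- x)\<close>.\<close>

lemma minimal_sublinear_minorant:
  assumes p: "sublinear_functional p"
  obtains q where "sublinear_functional q" "\<And>x. q x \<le> p x"
    "\<And>r. sublinear_functional r \<Longrightarrow> (\<And>x. r x \<le> q x) \<Longrightarrow> r = q"
proof -
  let ?A = "{q. sublinear_functional q \<and> (\<forall>x. q x \<le> p x)}"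
  let ?R = "relation_of (\<lambda>q r. r \<le> q) ?A"
  have "\<exists>m\<in>?A. \<forall>a\<in>?A. a \<le> m \<longrightarrow> a = m"
  proof (rule predicate_Zorn)
    show "partial_order_on ?A ?R"
      by (rule partial_order_on_relation_ofI) auto
  next
    fix C assume C: "C \<in> Chains ?R"
    show "\<exists>u\<in>?A. \<forall>a\<in>C. u \<le> a"
    proof (cases "C = {}")
      case True
      then show ?thesis using p by auto
    next
      case False
      have CA: "sublinear_functional q" "q x \<le> p x" if "q \<in> C" for q x
        using C that unfolding Chains_def relation_of_def by auto
      have chain: "q \<le> r \<or> r \<le> q" if "q \<in> C" "r \<in> C" for q r
        using C that unfolding Chains_def relation_of_def by auto
      define m where "m x = (INF q\<in>C. q x)" for x
      have bdd: "bdd_below ((\<lambda>q. q x) ` C)" for x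
      proof (rule bdd_belowI2)
        fix q assume q: "q \<in> C"
        show "- p (- x) \<le> q x"
          using sublinear_neg_le[OF CA(1)[OF q], of x] CA(2)[OF q, of "- x"] by linarith
      qed
      have low: "m x \<le> q x" if "q \<in> C" for q x
        unfolding m_def using bdd that by (rule cINF_lower)
      have great: "b \<le> m x" if "\<And>q. q \<in> C \<Longrightarrow> b \<le> q x" for b x
        unfolding m_def using False that by (intro cINF_greatest) auto
      have "sublinear_functional m"
      proof (rule sublinear_functionalI)
        fix x y
        have "m (x + y) - m x \<le> m y"
        proof (rule great)
          fix r assume r: "r \<in> C"
          have "m (x + y) - r y \<le> m x"
          proof (rule great)
            fix q assume q: "q \<in> C"
            (* the smaller of the two chain members bounds both values at once *)
            obtain s where s: "s \<in> C" "s \<le> q" "s \<le> r"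
              using chain[OF q r] q r by auto
            have "m (x + y) \<le> s x + s y"
              using low[OF s(1), of "x + y"] sublinear_add[OF CA(1)[OF s(1)], of x y] by simp
            then show "m (x + y) - r y \<le> q x"
              using le_funD[OF s(2), of x] le_funD[OF s(3), of y] by simp
          qed
          then show "m (x + y) - m x \<le> r y" by simp
        qed
        then show "m (x + y) \<le> m x + m y" by simp
      next
        fix c :: real and x assume c: "c > 0"
        have "m (c *\<^sub>R x) / c \<le> m x"
        proof (rule great)
          fix q assume q: "q \<in> C"
          show "m (c *\<^sub>R x) / c \<le> q x"
            using low[OF q, of "c *\<^sub>R x"] sublinear_scale_pos[OF CA(1)[OF q] c, of x] c
            by (simp add: field_simps)
        qed
        then show "m (c *\<^sub>R x) \<le> c * m x" using c by (simp add: field_simps)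
      qed
      moreover have "m x \<le> p x" for x
        using False low CA(2) by (meson all_not_in_conv order_trans)
      ultimately show ?thesis using low by (auto simp: le_fun_def)
    qed
  qed
  then obtain m where m: "m \<in> ?A" "\<And>a. a \<in> ?A \<Longrightarrow> a \<le> m \<Longrightarrow> a = m" by blast
  show ?thesis
  proof (rule that[of m])
    fix r assume r: "sublinear_functional r" "\<And>x. r x \<le> m x"
    then have "r \<in> ?A" using m(1) order_trans by fastforce
    then show "r = m" using m(2) r(2) by (auto simp: le_fun_def)
  qed (use m(1) in auto)
qed

text \<open>Minimality is applied below the tilt in the direction \<open>d\<close> rather than below \<open>p\<close> itself: the linear
  minorant \<open>s\<close> then satisfies \<open>s (- d) \<le> - p d\<close>, so it touches \<open>p\<close> at \<open>d\<close>.\<close>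

theorem Hahn_Banach_sublinear:
  assumes p: "sublinear_functional p"
  obtains s where "linear s" "\<And>x. s x \<le> p x" "s d = p d"
proof -
  obtain s where s: "sublinear_functional s" "\<And>x. s x \<le> tilt p d x"
    "\<And>r. sublinear_functional r \<Longrightarrow> (\<And>x. r x \<le> s x) \<Longrightarrow> r = s"
    using minimal_sublinear_minorant[OF tilt_sublinear[OF p]] by metis
  have lin: "linear s"
    by (rule minimal_sublinear_imp_linear[OF s(1,3)])
  have le: "s x \<le> p x" for x
    using s(2)[of x] tilt_le_self[OF p, of d x] by linarith
  have "- s d \<le> - p d"
    using s(2)[of "- d"] tilt_neg_direction[OF p, of d] linear_neg[OF lin, of d] by linarith
  then show ?thesis using that[OF lin le] le[of d] by (simp add: antisym)
qed

lemma linear_bounded_imp_blinfun: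
  fixes s :: "'a::real_normed_vector \<Rightarrow> real"
  assumes "linear s" "\<And>d. \<bar>s d\<bar> \<le> M * norm d"
  obtains s' :: "'a \<Rightarrow>\<^sub>L real" where "blinfun_apply s' = s"
proof -
  have "bounded_linear s"
    using assms by (intro bounded_linear_intro[where K = M])
      (auto simp: linear_add linear_scale mult.commute)
  then show ?thesis using that bounded_linear_Blinfun_apply by blast
qed

corollary Hahn_Banach_bounded_sublinear:
  fixes p :: "'a::real_normed_vector \<Rightarrow> real"
  assumes p: "sublinear_functional p" and bound: "\<And>x. p x \<le> M * norm x"
  obtains s :: "'a \<Rightarrow>\<^sub>L real" where "\<And>x. s x \<le> p x" "s d = p d"
proof -
  obtain s where s: "linear s" "\<And>x. s x \<le> p x" "s d = p d"
    using Hahn_Banach_sublinear[OF p] by metis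
  have "\<bar>s x\<bar> \<le> M * norm x" for x
    using s(2)[of x] s(2)[of "- x"] bound[of x] bound[of "- x"] linear_neg[OF s(1), of x] by auto
  then obtain s' :: "'a \<Rightarrow>\<^sub>L real" where "blinfun_apply s' = s"
    using linear_bounded_imp_blinfun[OF s(1)] by blast
  then show ?thesis using that[of s'] s by simp
qed

section \<open>Weak* compactness and weak* closed convex hulls\<close>

text \<open>Weak* compactness is transported to the product space of all real functions on \<open>X\<close>, where
  Tychonoff's theorem applies and compactness is that of a topological space type class; the
  embedding is \<open>blinfun_apply\<close>.\<close>

lemma tendsto_coordinatewise_iff:
  fixes l :: "'b \<Rightarrow> 'c::topological_space"
  shows "(f \<longlongrightarrow> l) F \<longleftrightarrow> (\<forall>i. ((\<lambda>\<nu>. f \<nu> i) \<longlongrightarrow> l i) F)"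
  unfolding limitin_canonical_iff[symmetric] euclidean_product_topology[symmetric]
    limitin_componentwise
  by (simp add: euclidean_product_topology)

lemma limitin_weak_star_iff:
  "limitin weak_star ss s F \<longleftrightarrow> (\<forall>d. ((\<lambda>\<nu>. blinfun_apply (ss \<nu>) d) \<longlongrightarrow> blinfun_apply s d) F)"
proof -
  have "limitin weak_star ss s F \<longleftrightarrow>
      (\<forall>V. open V \<longrightarrow> blinfun_apply s \<in> V \<longrightarrow> (\<forall>\<^sub>F \<nu> in F. blinfun_apply (ss \<nu>) \<in> V))"
    unfolding limitin_def strong_operator_topology_def openin_pullback_topology
      topspace_pullback_topology by (auto simp: open_openin[symmetric])
  then show ?thesis
    by (simp add: tendsto_def[symmetric] tendsto_coordinatewise_iff)
qed

lemma compact_PiE_UNIV: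
  fixes S :: "'i \<Rightarrow> 'b::topological_space set"
  assumes "\<And>i. compact (S i)"
  shows "compact (PiE UNIV S)"
proof -
  have "compactin (product_topology (\<lambda>i. euclidean) UNIV) (PiE UNIV S)"
    using assms by (simp add: compactin_PiE)
  then show ?thesis by (simp add: euclidean_product_topology)
qed

lemma compact_bounded_functionals:
  fixes M :: real
  shows "compact {s :: 'a::real_normed_vector \<Rightarrow> real. linear s \<and> (\<forall>d. \<bar>s d\<bar> \<le> M * norm d)}"
proof -
  have eval: "continuous_on UNIV (\<lambda>s :: 'a \<Rightarrow> real. s d)" for d
    by (rule continuous_on_product_coordinates)
  have "closed {s :: 'a \<Rightarrow> real. \<forall>x y. s (x + y) = s x + s y}"
    by (intro closed_Collect_all closed_Collect_eq continuous_on_add eval)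
  moreover have "closed {s :: 'a \<Rightarrow> real. \<forall>c x. s (c *\<^sub>R x) = c *\<^sub>R s x}"
    by (intro closed_Collect_all closed_Collect_eq continuous_on_scaleR continuous_on_const eval)
  ultimately have "closed ({s :: 'a \<Rightarrow> real. \<forall>x y. s (x + y) = s x + s y} \<inter>
      {s. \<forall>c x. s (c *\<^sub>R x) = c *\<^sub>R s x})"
    by (rule closed_Int)
  moreover have "compact (PiE UNIV (\<lambda>d::'a. {- (M * norm d)..M * norm d}))"
    by (rule compact_PiE_UNIV) simp
  ultimately have "compact (({s :: 'a \<Rightarrow> real. \<forall>x y. s (x + y) = s x + s y} \<inter>
      {s. \<forall>c x. s (c *\<^sub>R x) = c *\<^sub>R s x}) \<inter> PiE UNIV (\<lambda>d. {- (M * norm d)..M * norm d}))"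
    by (rule closed_Int_compact)
  also have "({s :: 'a \<Rightarrow> real. \<forall>x y. s (x + y) = s x + s y} \<inter>
      {s. \<forall>c x. s (c *\<^sub>R x) = c *\<^sub>R s x}) \<inter> PiE UNIV (\<lambda>d. {- (M * norm d)..M * norm d})
    = {s. linear s \<and> (\<forall>d. \<bar>s d\<bar> \<le> M * norm d)}"
    by (auto simp: linear_iff PiE_iff abs_le_iff minus_le_iff)
  finally show ?thesis .
qed

text \<open>The Banach--Alaoglu theorem in the form needed here.\<close>

lemma compact_weak_star_closed_bounded:
  fixes S :: "('a::real_normed_vector \<Rightarrow>\<^sub>L real) set"
  assumes closed: "closedin weak_star S"
    and bounded: "\<And>s d. s \<in> S \<Longrightarrow> \<bar>blinfun_apply s d\<bar> \<le> M * norm d"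
  shows "compact (blinfun_apply ` S)"
proof -
  have "openin weak_star (UNIV - S)"
    using closed by (simp add: closedin_def strong_operator_topology_topspace)
  then obtain V where V: "open V" "UNIV - S = blinfun_apply -` V"
    unfolding strong_operator_topology_def openin_pullback_topology by auto
  have mem: "s \<in> S \<longleftrightarrow> blinfun_apply s \<notin> V" for s
    using V(2) by blast
  have "blinfun_apply ` S = - V \<inter> {s. linear s \<and> (\<forall>d. \<bar>s d\<bar> \<le> M * norm d)}"
  proof (intro equalityI subsetI)
    fix s assume "s \<in> - V \<inter> {s. linear s \<and> (\<forall>d. \<bar>s d\<bar> \<le> M * norm d)}"
    moreover then obtain s' :: "'a \<Rightarrow>\<^sub>L real" where "blinfun_apply s' = s"
      using linear_bounded_imp_blinfun[of s M] by auto
    ultimately show "s \<in> blinfun_apply ` S" using mem[of s'] by auto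
  qed (use mem bounded in \<open>auto intro: bounded_linear.linear blinfun.bounded_linear_right\<close>)
  also have "compact \<dots>"
    using V(1) by (intro closed_Int_compact compact_bounded_functionals) (simp add: closed_Compl)
  finally show ?thesis .
qed

text \<open>Addition is only used as a map in one variable at a time, so separate continuity suffices.\<close>

lemma weak_star_closure_convex:
  assumes S: "convex S"
  shows "convex (weak_star closure_of S)"
proof -
  let ?cl = "\<lambda>S. weak_star closure_of S"
  have cont: "continuous_map weak_star weak_star (\<lambda>s. u *\<^sub>R a + v *\<^sub>R s)"
    "continuous_map weak_star weak_star (\<lambda>s. u *\<^sub>R s + v *\<^sub>R a)"
    for u v :: real and a :: "'a \<Rightarrow>\<^sub>L real"
    unfolding continuous_on_strong_operator_topo_iff_coordinatewise plus_blinfun.rep_eq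
      scaleR_blinfun.rep_eq real_scaleR_def
    by (intro allI continuous_map_add continuous_map_real_mult continuous_map_canonical_const
        strong_operator_topology_continuous_evaluation)+
  (* one endpoint still in S; the other one is freed afterwards *)
  have half: "u *\<^sub>R a + v *\<^sub>R s \<in> ?cl S"
    if "a \<in> S" "s \<in> ?cl S" "u \<ge> 0" "v \<ge> 0" "u + v = 1" for a s and u v :: real
  proof -
    have "(\<lambda>s. u *\<^sub>R a + v *\<^sub>R s) ` ?cl S \<subseteq> ?cl ((\<lambda>s. u *\<^sub>R a + v *\<^sub>R s) ` S)"
      by (rule continuous_map_image_closure_subset[OF cont(1)])
    also have "\<dots> \<subseteq> ?cl S"
      by (rule closure_of_mono) (use that S in \<open>auto simp: convex_def\<close>)
    finally show ?thesis using that(2) by blast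
  qed
  show ?thesis
    unfolding convex_def
  proof (intro ballI allI impI)
    fix r s and u v :: real
    assume "r \<in> ?cl S" "s \<in> ?cl S" "u \<ge> 0" "v \<ge> 0" "u + v = 1"
    have "(\<lambda>r. u *\<^sub>R r + v *\<^sub>R s) ` ?cl S \<subseteq> ?cl ((\<lambda>r. u *\<^sub>R r + v *\<^sub>R s) ` S)"
      by (rule continuous_map_image_closure_subset[OF cont(2)])
    also have "\<dots> \<subseteq> ?cl (?cl S)"
      by (rule closure_of_mono) (use half \<open>s \<in> ?cl S\<close> \<open>u \<ge> 0\<close> \<open>v \<ge> 0\<close> \<open>u + v = 1\<close> in auto)
    finally show "u *\<^sub>R r + v *\<^sub>R s \<in> ?cl S" using \<open>r \<in> ?cl S\<close> by auto
  qed
qed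

lemma convex_weak_star_closed_hull: "convex (weak_star_closed_hull S)"
  unfolding weak_star_closed_hull_def by (intro weak_star_closure_convex convex_convex_hull)

lemma closedin_weak_star_closed_hull: "closedin weak_star (weak_star_closed_hull S)"
  unfolding weak_star_closed_hull_def by (rule closedin_closure_of)

lemma subset_weak_star_closed_hull: "S \<subseteq> weak_star_closed_hull S"
  unfolding weak_star_closed_hull_def
  by (metis closure_of_subset hull_subset order_trans strong_operator_topology_topspace subset_UNIV)

lemma weak_star_closed_hull_mono: "S \<subseteq> S' \<Longrightarrow> weak_star_closed_hull S \<subseteq> weak_star_closed_hull S'"
  unfolding weak_star_closed_hull_def by (intro closure_of_mono hull_mono)

lemma closedin_weak_star_halfspace: "closedin weak_star {s. blinfun_apply s d \<le> c}"
proof -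
  have "closedin weak_star {s \<in> topspace weak_star. blinfun_apply s d \<in> {..c}}"
    by (rule closedin_continuous_map_preimage[OF strong_operator_topology_continuous_evaluation])
      simp
  then show ?thesis by (simp add: strong_operator_topology_topspace)
qed

lemma convex_halfspace_functional: "convex {s :: 'a::real_normed_vector \<Rightarrow>\<^sub>L real. blinfun_apply s d \<le> c}"
proof (rule convexI)
  fix s t :: "'a \<Rightarrow>\<^sub>L real" and u v :: real
  assume "s \<in> {s. blinfun_apply s d \<le> c}" "t \<in> {s. blinfun_apply s d \<le> c}" "0 \<le> u" "0 \<le> v" "u + v = 1"
  then show "u *\<^sub>R s + v *\<^sub>R t \<in> {s. blinfun_apply s d \<le> c}"
    using convex_bound_le[of "s d" c "t d" u v] by (simp add: plus_blinfun.rep_eq scaleR_blinfun.rep_eq)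
qed

lemma weak_star_closed_hull_le:
  assumes "\<And>s. s \<in> S \<Longrightarrow> blinfun_apply s d \<le> c" "s \<in> weak_star_closed_hull S"
  shows "blinfun_apply s d \<le> c"
proof -
  have "convex hull S \<subseteq> {s. blinfun_apply s d \<le> c}"
    using assms(1) by (intro hull_minimal convex_halfspace_functional) auto
  then have "weak_star_closed_hull S \<subseteq> {s. blinfun_apply s d \<le> c}"
    unfolding weak_star_closed_hull_def
    by (rule closure_of_minimal[OF _ closedin_weak_star_halfspace])
  then show ?thesis using assms(2) by blast
qed

text \<open>Compactness in filter form: refining the filter plays the role of passing to a subnet, and limits
  along \<open>F\<close> persist along the finer \<open>F'\<close>.\<close>

lemma compactin_cluster_filter:
  assumes K: "compactin X K" and F: "F \<noteq> bot" and ev: "\<forall>\<^sub>F \<nu> in F. xs \<nu> \<in> K"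
  obtains x F' where "x \<in> K" "F' \<le> F" "F' \<noteq> bot" "limitin X xs x F'"
proof -
  have "\<exists>x\<in>K. \<forall>W. openin X W \<and> x \<in> W \<longrightarrow> (\<exists>\<^sub>F \<nu> in F. xs \<nu> \<in> W)"
  proof (rule ccontr)
    assume "\<not> ?thesis"
    then obtain W where W: "\<And>x. x \<in> K \<Longrightarrow> openin X (W x) \<and> x \<in> W x \<and> (\<forall>\<^sub>F \<nu> in F. xs \<nu> \<notin> W x)"
      by (simp only: not_frequently[symmetric]) metis
    obtain D where D: "finite D" "D \<subseteq> W ` K" "K \<subseteq> \<Union>D"
      using compactinD[OF K, of "W ` K"] W by blast
    have "\<forall>\<^sub>F \<nu> in F. \<forall>w\<in>D. xs \<nu> \<notin> w"
      using D(1,2) W by (intro eventually_ball_finite) auto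
    then have "\<forall>\<^sub>F \<nu> in F. False"
      using ev by eventually_elim (use D(3) in blast)
    then show False using F by (simp add: eventually_False)
  qed
  then obtain x where x: "x \<in> K" "\<And>W. openin X W \<Longrightarrow> x \<in> W \<Longrightarrow> \<exists>\<^sub>F \<nu> in F. xs \<nu> \<in> W"
    by blast
  have xX: "x \<in> topspace X" using x(1) K unfolding compactin_def by blast
  let ?F' = "inf F (filtercomap xs (nhdsin X x))"
  have "?F' \<noteq> bot"
  proof
    assume "?F' = bot"
    then have "\<forall>\<^sub>F \<nu> in ?F'. False" by simp
    then obtain Q R where Q: "eventually Q F" and R: "eventually R (filtercomap xs (nhdsin X x))"
      and QR: "\<And>\<nu>. Q \<nu> \<Longrightarrow> R \<nu> \<Longrightarrow> False"
      unfolding eventually_inf by blast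
    from R obtain P where P: "eventually P (nhdsin X x)" "\<And>\<nu>. P (xs \<nu>) \<Longrightarrow> R \<nu>"
      unfolding eventually_filtercomap by blast
    then obtain W where W: "openin X W" "x \<in> W" "\<And>y. y \<in> W \<Longrightarrow> P y"
      using xX unfolding eventually_nhdsin by blast
    from Q have "\<forall>\<^sub>F \<nu> in F. xs \<nu> \<notin> W"
      by eventually_elim (use P(2) W(3) QR in blast)
    then show False using x(2)[OF W(1,2)] by (simp add: frequently_def)
  qed
  moreover have "limitin X xs x ?F'"
    unfolding limitin_def
  proof (intro conjI allI impI xX)
    fix W assume W: "openin X W \<and> x \<in> W"
    then have "eventually (\<lambda>y. y \<in> W) (nhdsin X x)"
      unfolding eventually_nhdsin by blast
    then have "\<forall>\<^sub>F \<nu> in filtercomap xs (nhdsin X x). xs \<nu> \<in> W"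
      unfolding eventually_filtercomap by blast
    then show "\<forall>\<^sub>F \<nu> in ?F'. xs \<nu> \<in> W"
      using filter_leD[OF inf_le2] by blast
  qed
  ultimately show ?thesis using that[OF x(1), of ?F'] by simp
qed

lemma bounded_functionals_cluster_filter:
  fixes ss :: "'i \<Rightarrow> ('a::real_normed_vector \<Rightarrow>\<^sub>L real)"
  assumes "F \<noteq> bot" "\<forall>\<^sub>F \<nu> in F. \<forall>d. \<bar>ss \<nu> d\<bar> \<le> M * norm d"
  obtains s F' where "F' \<le> F" "F' \<noteq> bot" "limitin weak_star ss s F'"
proof -
  have ev: "\<forall>\<^sub>F \<nu> in F. blinfun_apply (ss \<nu>) \<in> {s. linear s \<and> (\<forall>d. \<bar>s d\<bar> \<le> M * norm d)}"
    using assms(2) by eventually_elim (auto intro: bounded_linear.linear blinfun.bounded_linear_right)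
  have "compactin euclidean {s :: 'a \<Rightarrow> real. linear s \<and> (\<forall>d. \<bar>s d\<bar> \<le> M * norm d)}"
    using compact_bounded_functionals by simp
  from compactin_cluster_filter[OF this assms(1) ev]
  obtain h F' where h: "h \<in> {s. linear s \<and> (\<forall>d. \<bar>s d\<bar> \<le> M * norm d)}" "F' \<le> F" "F' \<noteq> bot"
      "limitin euclidean (\<lambda>\<nu>. blinfun_apply (ss \<nu>)) h F'" .
  obtain s :: "'a \<Rightarrow>\<^sub>L real" where s: "blinfun_apply s = h"
    using h(1) linear_bounded_imp_blinfun[of h M] by auto
  have "limitin weak_star ss s F'"
    using h(4) by (simp add: limitin_weak_star_iff s tendsto_coordinatewise_iff)
  then show ?thesis using that h(2,3) by blast
qed

section \<open>A theorem of the alternative for weak* compact convex sets\<close>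

text \<open>Weak* compactness lets finitely many directions \<open>D\<close> detect that \<open>0\<close> is missing from \<open>S\<close>, so the
  problem is Euclidean: the point \<open>s0\<close> of \<open>S\<close> that minimises \<open>\<Sum>d\<in>D. (s d)\<^sup>2\<close> yields the separating
  direction \<open>e = - (\<Sum>d\<in>D. s0 d *\<^sub>R d)\<close> by the variational inequality for a projection.\<close>

lemma separate_zero_weak_star:
  fixes S :: "('a::real_normed_vector \<Rightarrow>\<^sub>L real) set"
  assumes convex: "convex S" and compact: "compact (blinfun_apply ` S)" and zero: "0 \<notin> S"
  obtains e where "\<And>s. s \<in> S \<Longrightarrow> blinfun_apply s e < 0"
proof (cases "S = {}")
  case False
  have "\<exists>d. blinfun_apply s d \<noteq> 0" if "s \<in> S" for s
    using that zero by (metis blinfun_eqI zero_blinfun.rep_eq)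
  then have cover: "blinfun_apply ` S \<subseteq> (\<Union>d. {c. c d \<noteq> 0})"
    by auto
  have "open {c :: 'a \<Rightarrow> real. c d \<noteq> 0}" for d
    by (intro open_Collect_neq continuous_on_const continuous_on_product_coordinates)
  then obtain D where D: "finite D" "blinfun_apply ` S \<subseteq> (\<Union>d\<in>D. {c. c d \<noteq> 0})"
    using compactE_image[OF compact _ cover] by (metis (no_types, lifting))
  define N where "N c = (\<Sum>d\<in>D. (c d)\<^sup>2)" for c :: "'a \<Rightarrow> real"
  have "continuous_on (blinfun_apply ` S) N"
    unfolding N_def
    by (intro continuous_on_sum continuous_on_power
        continuous_on_subset[OF continuous_on_product_coordinates]) auto
  then have "\<exists>c\<in>blinfun_apply ` S. \<forall>c'\<in>blinfun_apply ` S. N c \<le> N c'"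
    using continuous_attains_inf[OF compact] False by blast
  then obtain s0 where s0: "s0 \<in> S" "\<And>s. s \<in> S \<Longrightarrow> N s0 \<le> N s"
    by blast
  obtain d0 where d0: "d0 \<in> D" "blinfun_apply s0 d0 \<noteq> 0"
    using D(2) s0(1) by auto
  have "N s0 > 0"
    unfolding N_def using D(1) d0 by (intro sum_pos2[of D d0]) auto
  define e where "e = - (\<Sum>d\<in>D. blinfun_apply s0 d *\<^sub>R d)"
  have e: "blinfun_apply s e = - (\<Sum>d\<in>D. s0 d * s d)" for s :: "'a \<Rightarrow>\<^sub>L real"
    by (simp add: e_def blinfun.minus_right blinfun.sum_right blinfun.scaleR_right)
  have "blinfun_apply s e < 0" if s: "s \<in> S" for s
  proof -
    define B where "B = (\<Sum>d\<in>D. s0 d * (s d - s0 d))"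
    define C where "C = (\<Sum>d\<in>D. (s d - s0 d)\<^sup>2)"
    have C: "C \<ge> 0" unfolding C_def by (simp add: sum_nonneg)
    (* expansion of N along the segment from s0 to s; letting t tend to 0 gives B >= 0 *)
    have quad: "0 \<le> 2 * B + t * C" if t: "0 < t" "t \<le> 1" for t
    proof -
      have "(1 - t) *\<^sub>R s0 + t *\<^sub>R s \<in> S"
        using convex s0(1) s t by (simp add: convex_alt)
      then have "N s0 \<le> N ((1 - t) *\<^sub>R s0 + t *\<^sub>R s)"
        by (rule s0(2))
      also have "\<dots> = N s0 + t * (2 * B + t * C)"
        unfolding N_def B_def C_def plus_blinfun.rep_eq scaleR_blinfun.rep_eq
          sum_distrib_left sum.distrib[symmetric]
        by (rule sum.cong) (auto simp: power2_eq_square algebra_simps)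
      finally show ?thesis using t by (simp add: zero_le_mult_iff)
    qed
    have "B \<ge> 0"
    proof (rule ccontr)
      assume "\<not> B \<ge> 0"
      define t where "t = min 1 (- B / (C + 1))"
      have t: "0 < t" "t \<le> 1" "t \<le> - B / (C + 1)"
        using \<open>\<not> B \<ge> 0\<close> C by (auto simp: t_def field_simps)
      have "t * (C + 1) \<le> - B"
        using t(3) C by (simp add: field_simps)
      then show False
        using quad[OF t(1,2)] t(1) \<open>\<not> B \<ge> 0\<close> by (simp add: algebra_simps)
    qed
    then have "N s0 \<le> (\<Sum>d\<in>D. s0 d * s d)"
      by (simp add: B_def N_def algebra_simps power2_eq_square sum_subtractf)
    then show ?thesis using \<open>N s0 > 0\<close> by (simp add: e)
  qed
  then show ?thesis using that by blast
qed (use that in auto)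

text \<open>The hull is the continuous image of the simplex of weights times the product of the \<open>A k\<close>.  This is
  why no closure is needed in the alternative below, and hence why the multiplier rule holds with an
  exact sum.\<close>

lemma compact_convex_hull_finite_union_weak_star:
  fixes A :: "'k \<Rightarrow> ('a::real_normed_vector \<Rightarrow>\<^sub>L real) set"
  assumes K: "finite K"
    and A: "\<And>k. k \<in> K \<Longrightarrow> A k \<noteq> {} \<and> convex (A k) \<and> compact (blinfun_apply ` A k)"
  shows "compact (blinfun_apply ` (convex hull (\<Union>(A ` K))))"
proof -
  (* coordinates outside K are pinned to 0 so that both factors are products of compact sets *)
  let ?W = "PiE UNIV (\<lambda>k. if k \<in> K then {0..1} else {0::real}) \<inter> {l. sum l K = 1}"
  let ?P = "PiE UNIV (\<lambda>k. if k \<in> K then blinfun_apply ` A k else {\<lambda>_. 0})"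
  let ?Z = "\<lambda>(l, a) d. \<Sum>k\<in>K. l k * (a k d :: real)"
  have "closed {l :: 'k \<Rightarrow> real. sum l K = 1}"
    by (intro closed_Collect_eq continuous_on_sum continuous_on_const
        continuous_on_product_coordinates)
  then have "compact ?W"
    by (intro compact_Int_closed compact_PiE_UNIV) auto
  moreover have "compact ?P"
    using A by (intro compact_PiE_UNIV) auto
  ultimately have cpt: "compact (?W \<times> ?P)"
    by (rule compact_Times)
  have weight: "continuous_on UNIV (\<lambda>z :: ('k \<Rightarrow> real) \<times> ('k \<Rightarrow> 'a \<Rightarrow> real). fst z k)" for k
    by (rule continuous_on_product_then_coordinatewise[OF continuous_on_fst[OF continuous_on_id]])
  have point: "continuous_on UNIV (\<lambda>z :: ('k \<Rightarrow> real) \<times> ('k \<Rightarrow> 'a \<Rightarrow> real). snd z k d)" for k d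
    by (rule continuous_on_product_then_coordinatewise[OF continuous_on_product_then_coordinatewise[
          OF continuous_on_snd[OF continuous_on_id]]])
  have "continuous_on (?W \<times> ?P) (\<lambda>z d. \<Sum>k\<in>K. fst z k * snd z k d)"
    by (intro continuous_on_coordinatewise_then_product continuous_on_sum continuous_on_mult
        continuous_on_subset[OF weight] continuous_on_subset[OF point] subset_UNIV)
  then have "continuous_on (?W \<times> ?P) ?Z"
    by (simp add: case_prod_beta')
  then have "compact (?Z ` (?W \<times> ?P))"
    using cpt by (rule compact_continuous_image)
  also have "?Z ` (?W \<times> ?P) = blinfun_apply ` (convex hull (\<Union>(A ` K)))"
  proof -
    have hull: "convex hull (\<Union>(A ` K)) =
      {sum (\<lambda>i. c i *\<^sub>R s i) K | c s. (\<forall>i\<in>K. c i \<ge> 0) \<and> sum c K = 1 \<and> (\<forall>i\<in>K. s i \<in> A i)}"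
      using A by (intro convex_hull_finite_union K) auto
    show ?thesis
    proof (intro equalityI subsetI)
      fix h assume "h \<in> ?Z ` (?W \<times> ?P)"
      then obtain l a where la: "l \<in> ?W" "a \<in> ?P" "h = ?Z (l, a)" by auto
      have "\<forall>k\<in>K. \<exists>s\<in>A k. a k = blinfun_apply s"
      proof
        fix k assume "k \<in> K"
        then have "a k \<in> blinfun_apply ` A k"
          using PiE_mem[OF la(2), of k] by simp
        then show "\<exists>s\<in>A k. a k = blinfun_apply s" by blast
      qed
      then obtain s where s: "\<And>k. k \<in> K \<Longrightarrow> s k \<in> A k \<and> a k = blinfun_apply (s k)"
        by metis
      have "l k \<ge> 0" if "k \<in> K" for k
        using la(1) that by (auto simp: PiE_iff split: if_splits)
      moreover have "sum l K = 1" using la(1) by simp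
      ultimately have "(\<Sum>k\<in>K. l k *\<^sub>R s k) \<in> convex hull (\<Union>(A ` K))"
        unfolding hull using s by blast
      moreover have "h = blinfun_apply (\<Sum>k\<in>K. l k *\<^sub>R s k)"
        using s by (auto simp: la(3) fun_eq_iff blinfun.sum_left blinfun.scaleR_left)
      ultimately show "h \<in> blinfun_apply ` (convex hull (\<Union>(A ` K)))" by blast
    next
      fix h assume "h \<in> blinfun_apply ` (convex hull (\<Union>(A ` K)))"
      then obtain c s where cs: "\<forall>i\<in>K. c i \<ge> 0" "sum c K = 1" "\<forall>i\<in>K. s i \<in> A i"
        "h = blinfun_apply (\<Sum>k\<in>K. c k *\<^sub>R s k)"
        unfolding hull by blast
      define l where "l k = (if k \<in> K then c k else 0)" for k
      define a where "a k = (if k \<in> K then blinfun_apply (s k) else (\<lambda>_. 0))" for k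
      have "c k \<le> 1" if "k \<in> K" for k
        using member_le_sum[of k K c] cs(1,2) K that by auto
      then have "l \<in> ?W" using cs(1,2) by (auto simp: l_def PiE_iff)
      moreover have "a \<in> ?P" using cs(3) by (auto simp: a_def PiE_iff)
      moreover have "h = ?Z (l, a)"
        by (auto simp: cs(4) l_def a_def fun_eq_iff blinfun.sum_left blinfun.scaleR_left)
      ultimately show "h \<in> ?Z ` (?W \<times> ?P)" by blast
    qed
  qed
  finally show ?thesis .
qed

theorem Gordan_alternative_weak_star:
  fixes A :: "'k \<Rightarrow> ('a::real_normed_vector \<Rightarrow>\<^sub>L real) set"
  assumes K: "finite K"
    and A: "\<And>k. k \<in> K \<Longrightarrow> A k \<noteq> {} \<and> convex (A k) \<and> compact (blinfun_apply ` A k)"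
    and no_descent: "\<And>e. \<exists>k\<in>K. \<exists>s\<in>A k. 0 \<le> blinfun_apply s e"
  obtains l a where "\<And>k. k \<in> K \<Longrightarrow> 0 \<le> l k" "sum l K = 1" "\<And>k. k \<in> K \<Longrightarrow> a k \<in> A k"
    "(\<Sum>k\<in>K. l k *\<^sub>R a k) = 0"
proof -
  have "0 \<in> convex hull (\<Union>(A ` K))"
  proof (rule ccontr)
    assume "0 \<notin> convex hull (\<Union>(A ` K))"
    then obtain e where "\<And>s. s \<in> convex hull (\<Union>(A ` K)) \<Longrightarrow> blinfun_apply s e < 0"
      using separate_zero_weak_star[OF convex_convex_hull
          compact_convex_hull_finite_union_weak_star[of K A, OF K A]] by blast
    then show False
      using no_descent[of e] by (meson UN_I hull_inc not_le)
  qed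
  moreover have "convex hull (\<Union>(A ` K)) =
      {sum (\<lambda>i. c i *\<^sub>R s i) K | c s. (\<forall>i\<in>K. c i \<ge> 0) \<and> sum c K = 1 \<and> (\<forall>i\<in>K. s i \<in> A i)}"
    using A by (intro convex_hull_finite_union K) auto
  ultimately obtain c s where "\<forall>i\<in>K. c i \<ge> 0" "sum c K = 1" "\<forall>i\<in>K. s i \<in> A i"
      "0 = (\<Sum>k\<in>K. c k *\<^sub>R s k)"
    by blast
  then show ?thesis using that[of c s] by simp
qed

section \<open>Clarke directional derivatives and subdifferentials\<close>

abbreviation clarke_filter :: "'a::real_normed_vector \<Rightarrow> ('a \<times> real) filter" where
  "clarke_filter x \<equiv> nhds x \<times>\<^sub>F at_right 0"

lemma clarke_filter_neq_bot: "clarke_filter x \<noteq> bot"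
  by (simp add: prod_filter_eq_bot)

lemmas filterlim_fst_clarke = filterlim_fst[of "nhds x" "at_right (0::real)" for x]

lemmas filterlim_snd_clarke = filterlim_snd[of "at_right (0::real)" "nhds x" for x]

lemma tendsto_snd_clarke: "(snd \<longlongrightarrow> 0) (clarke_filter x)"
  using filterlim_snd_clarke[of x] by (simp add: filterlim_at)

lemma eventually_pos_clarke: "\<forall>\<^sub>F z in clarke_filter x. 0 < snd z"
  using eventually_compose_filterlim[OF eventually_at_right_less filterlim_snd_clarke] .

lemma filterlim_translate_clarke:
  "filterlim (\<lambda>z. fst z + snd z *\<^sub>R d) (nhds x) (clarke_filter x)"
proof -
  have "((\<lambda>z. fst z + snd z *\<^sub>R d) \<longlongrightarrow> x + 0 *\<^sub>R d) (clarke_filter x)"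
    by (intro tendsto_add tendsto_scaleR tendsto_const filterlim_fst tendsto_snd_clarke)
  then show ?thesis by simp
qed

lemma filterlim_clarke_shift:
  "filterlim (\<lambda>z. (fst z + snd z *\<^sub>R d, snd z)) (clarke_filter x) (clarke_filter x)"
  by (intro filterlim_Pair filterlim_translate_clarke filterlim_snd_clarke)

lemma filterlim_clarke_rescale:
  assumes "c > 0"
  shows "filterlim (\<lambda>z. (fst z, c * snd z)) (clarke_filter x) (clarke_filter x)"
proof (intro filterlim_Pair filterlim_fst_clarke)
  have "((\<lambda>z. c * snd z) \<longlongrightarrow> 0) (clarke_filter x)"
    by (rule tendsto_mult_right_zero[OF tendsto_snd_clarke])
  then show "filterlim (\<lambda>z. c * snd z) (at_right 0) (clarke_filter x)"
    using eventually_pos_clarke[of x] assms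
    by (auto simp: filterlim_at elim!: eventually_mono)
qed

text \<open>Constraints are extended-real-valued but finite near the point in question; the calculus is
  carried out for a real representative \<open>\<psi>\<close> of such a function \<open>\<phi>\<close>.\<close>

lemma clarke_dir_finite:
  assumes "\<forall>\<^sub>F y in nhds x. \<phi> y = ereal (\<psi> y)"
  shows "clarke_dir \<phi> x d =
    Limsup (clarke_filter x) (\<lambda>z. ereal ((\<psi> (fst z + snd z *\<^sub>R d) - \<psi> (fst z)) / snd z))"
  unfolding clarke_dir_def
proof (rule Limsup_eq)
  show "\<forall>\<^sub>F z in clarke_filter x. (case z of (y, t) \<Rightarrow> (\<phi> (y + t *\<^sub>R d) - \<phi> y) / ereal t) =
      ereal ((\<psi> (fst z + snd z *\<^sub>R d) - \<psi> (fst z)) / snd z)"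
    using eventually_pos_clarke[of x]
      eventually_compose_filterlim[OF assms filterlim_fst_clarke]
      eventually_compose_filterlim[OF assms filterlim_translate_clarke[of d]]
    by eventually_elim (auto simp: case_prod_beta)
qed

text \<open>The difference quotient in the direction \<open>d + d'\<close> at \<open>y\<close> is the sum of the one in the direction \<open>d\<close>
  at \<open>y\<close> and the one in the direction \<open>d'\<close> at \<open>y + t d\<close>.  Moving the base point is harmless because
  the limsup runs over all base points near \<open>x\<close>.\<close>

proposition clarke_dir_sublinear:
  fixes x :: "'a::real_normed_vector"
  assumes B: "open B" "x \<in> B" and lip: "L-lipschitz_on B \<psi>"
    and fin: "\<And>y. y \<in> B \<Longrightarrow> \<phi> y = ereal (\<psi> y)"
  obtains p where "sublinear_functional p" "\<And>d. \<bar>p d\<bar> \<le> L * norm d"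
    "\<And>d. clarke_dir \<phi> x d = ereal (p d)"
proof -
  let ?F = "clarke_filter x"
  define Q where "Q d z = (\<psi> (fst z + snd z *\<^sub>R d) - \<psi> (fst z)) / snd z" for d and z :: "'a \<times> real"
  have inB: "\<forall>\<^sub>F y in nhds x. y \<in> B"
    using B eventually_nhds by blast
  have lim: "clarke_dir \<phi> x d = Limsup ?F (\<lambda>z. ereal (Q d z))" for d
    unfolding Q_def using inB by (intro clarke_dir_finite) (auto elim: eventually_mono intro: fin)
  have bound: "\<forall>\<^sub>F z in ?F. \<bar>Q d z\<bar> \<le> L * norm d" for d
    using eventually_pos_clarke[of x]
      eventually_compose_filterlim[OF inB filterlim_fst_clarke]
      eventually_compose_filterlim[OF inB filterlim_translate_clarke[of d]]
  proof eventually_elim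
    case (elim z)
    have "\<bar>\<psi> (fst z + snd z *\<^sub>R d) - \<psi> (fst z)\<bar> \<le> L * (snd z * norm d)"
      using lipschitz_onD[OF lip elim(3,2)] elim(1) by (simp add: dist_norm)
    then show ?case using elim(1) by (simp add: Q_def field_simps)
  qed
  have upper: "clarke_dir \<phi> x d \<le> ereal (L * norm d)" for d
    unfolding lim using bound[of d] by (intro Limsup_bounded) (auto elim!: eventually_mono)
  have lower: "ereal (- (L * norm d)) \<le> clarke_dir \<phi> x d" for d
    unfolding lim using bound[of d]
    by (intro le_Limsup clarke_filter_neq_bot) (auto elim!: eventually_mono)
  define p where "p d = real_of_ereal (clarke_dir \<phi> x d)" for d
  have p: "clarke_dir \<phi> x d = ereal (p d) \<and> \<bar>p d\<bar> \<le> L * norm d" for d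
    using upper[of d] lower[of d] by (cases "clarke_dir \<phi> x d") (auto simp: p_def)
  then have lim_p: "Limsup ?F (\<lambda>z. ereal (Q d z)) = ereal (p d)" for d
    by (simp flip: lim)
  have up: "\<forall>\<^sub>F z in ?F. Q d z < r" if "p d < r" for d r
    using Limsup_lessD[of ?F "\<lambda>z. ereal (Q d z)" "ereal r"] that by (simp add: lim_p)
  have low: "p d \<le> r" if "\<forall>\<^sub>F z in ?F. Q d z < r" for d r
  proof -
    have "\<forall>\<^sub>F z in ?F. ereal (Q d z) \<le> ereal r"
      using that by eventually_elim simp
    then have "Limsup ?F (\<lambda>z. ereal (Q d z)) \<le> ereal r" by (rule Limsup_bounded)
    then show ?thesis by (simp add: lim_p)
  qed
  have "sublinear_functional p"
  proof (rule sublinear_functionalI)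
    fix d d'
    show "p (d + d') \<le> p d + p d'"
    proof (rule field_le_epsilon)
      fix e :: real assume e: "e > 0"
      have "p d < p d + e / 2" "p d' < p d' + e / 2" using e by simp_all
      from up[OF this(1)] eventually_compose_filterlim[OF up[OF this(2)] filterlim_clarke_shift[of d]]
      have "\<forall>\<^sub>F z in ?F. Q (d + d') z < p d + p d' + e"
      proof eventually_elim
        case (elim z)
        have "Q (d + d') z = Q d' (fst z + snd z *\<^sub>R d, snd z) + Q d z"
          by (simp add: Q_def add_divide_distrib[symmetric] scaleR_add_right add.assoc)
        then show ?case using elim by simp
      qed
      then show "p (d + d') \<le> p d + p d' + e" by (rule low)
    qed
  next
    fix c :: real and d assume c: "c > 0"
    show "p (c *\<^sub>R d) \<le> c * p d"
    proof (rule field_le_epsilon)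
      fix e :: real assume e: "e > 0"
      have "p d < p d + e / c" using e c by simp
      from eventually_compose_filterlim[OF up[OF this] filterlim_clarke_rescale[OF c]]
      have "\<forall>\<^sub>F z in ?F. Q (c *\<^sub>R d) z < c * p d + e"
      proof eventually_elim
        case (elim z)
        have "Q (c *\<^sub>R d) z = c * Q d (fst z, c * snd z)"
          using c by (simp add: Q_def mult.commute)
        then show ?case using elim c by (simp add: field_simps)
      qed
      then show "p (c *\<^sub>R d) \<le> c * p d + e" by (rule low)
    qed
  qed
  then show ?thesis using that p by blast
qed

text \<open>By the Hahn--Banach theorem the directional derivative, being sublinear and bounded, is the support
  function of the subdifferential, with the supremum attained.  In particular the subdifferential is
  nonempty.\<close>

lemma clarke_subdiff_attains:
  fixes x :: "'a::real_normed_vector"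
  assumes "open B" "x \<in> B" "L-lipschitz_on B \<psi>" "\<And>y. y \<in> B \<Longrightarrow> \<phi> y = ereal (\<psi> y)"
  obtains s where "s \<in> clarke_subdiff \<phi> x" "ereal (blinfun_apply s d) = clarke_dir \<phi> x d"
proof -
  obtain p where p: "sublinear_functional p" "\<And>d. \<bar>p d\<bar> \<le> L * norm d"
    "\<And>d. clarke_dir \<phi> x d = ereal (p d)"
    using clarke_dir_sublinear[OF assms] by blast
  obtain s :: "'a \<Rightarrow>\<^sub>L real" where "\<And>y. s y \<le> p y" "s d = p d"
    using Hahn_Banach_bounded_sublinear[OF p(1), of L d] p(2) abs_le_D1 by metis
  then show ?thesis using that[of s] by (simp add: clarke_subdiff_def p(3))
qed

lemma clarke_subdiff_bounded:
  fixes x :: "'a::real_normed_vector"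
  assumes "open B" "x \<in> B" "L-lipschitz_on B \<psi>" "\<And>y. y \<in> B \<Longrightarrow> \<phi> y = ereal (\<psi> y)"
    and s: "s \<in> clarke_subdiff \<phi> x"
  shows "\<bar>blinfun_apply s d\<bar> \<le> L * norm d"
proof -
  obtain p where p: "\<And>d. \<bar>p d\<bar> \<le> L * norm d" "\<And>d. clarke_dir \<phi> x d = ereal (p d)"
    using clarke_dir_sublinear[OF assms(1-4)] by metis
  have "blinfun_apply s d \<le> p d" "blinfun_apply s (- d) \<le> p (- d)"
    using s by (auto simp: clarke_subdiff_def p(2))
  then show ?thesis
    using p(1)[of d] p(1)[of "- d"] by (simp add: blinfun.minus_right)
qed

lemma
  shows closedin_clarke_subdiff: "closedin weak_star (clarke_subdiff \<phi> x)"
    and convex_clarke_subdiff: "convex (clarke_subdiff \<phi> x)"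
proof -
  have "closedin weak_star {s. ereal (blinfun_apply s d) \<le> c} \<and> convex {s. ereal (blinfun_apply s d) \<le> c}"
    for c and d :: 'a
    using closedin_topspace[of "weak_star :: ('a \<Rightarrow>\<^sub>L real) topology"]
    by (cases c) (auto simp: closedin_weak_star_halfspace convex_halfspace_functional
        strong_operator_topology_topspace)
  moreover have "clarke_subdiff \<phi> x = (\<Inter>d. {s. ereal (blinfun_apply s d) \<le> clarke_dir \<phi> x d})"
    by (auto simp: clarke_subdiff_def)
  ultimately show "closedin weak_star (clarke_subdiff \<phi> x)" "convex (clarke_subdiff \<phi> x)"
    by (auto intro!: closedin_INT convex_INT)
qed

lemma clarke_dir_less_imp_eventually_less:
  fixes f :: "'a::real_normed_vector \<Rightarrow> real"
  assumes "clarke_dir (\<lambda>y. ereal (f y)) x d < ereal c"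
  shows "\<forall>\<^sub>F t in at_right 0. f (x + t *\<^sub>R d) - f x < c * t"
proof -
  have "\<forall>\<^sub>F z in clarke_filter x. (case z of (y, t) \<Rightarrow> (ereal (f (y + t *\<^sub>R d)) - ereal (f y)) / ereal t) < ereal c"
    using assms unfolding clarke_dir_def by (rule Limsup_lessD)
  moreover have "filterlim (\<lambda>t. (x, t)) (clarke_filter x) (at_right 0)"
    by (intro filterlim_Pair tendsto_const filterlim_ident)
  ultimately have "\<forall>\<^sub>F t in at_right 0. (ereal (f (x + t *\<^sub>R d)) - ereal (f x)) / ereal t < ereal c"
    using eventually_compose_filterlim by fastforce
  then show ?thesis
    using eventually_at_right_less[of "0::real"]
    by eventually_elim (simp add: field_simps)
qed

text \<open>A weak form of Lebourg's mean value theorem.  If the derivative were below the mean slope \<open>c\<close> at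
  every point of the segment, then all sufficiently short chords around each point would have slope
  less than \<open>c\<close>, because the limsup admits moving base points; chaining chords gives slope less than
  \<open>c\<close> on the whole segment.\<close>

proposition clarke_mean_value:
  fixes x d :: "'a::real_normed_vector"
  assumes t: "t > 0" and fin: "\<And>s. 0 \<le> s \<Longrightarrow> s \<le> t \<Longrightarrow> \<phi> (x + s *\<^sub>R d) = ereal (\<psi> s)"
  obtains s where "0 \<le> s" "s \<le> t" "ereal ((\<psi> t - \<psi> 0) / t) \<le> clarke_dir \<phi> (x + s *\<^sub>R d) d"
proof (rule ccontr)
  assume "\<not> thesis"
  then have less: "clarke_dir \<phi> (x + s *\<^sub>R d) d < ereal ((\<psi> t - \<psi> 0) / t)" if "0 \<le> s" "s \<le> t" for s
    using that \<open>\<And>s. \<lbrakk>0 \<le> s; s \<le> t; _\<rbrakk> \<Longrightarrow> thesis\<close> not_le by blast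
  define c where "c = (\<psi> t - \<psi> 0) / t"
  define P where "P u v \<longleftrightarrow> (0 \<le> u \<longrightarrow> u < v \<longrightarrow> v \<le> t \<longrightarrow> \<psi> v - \<psi> u < c * (v - u))" for u v
  (* Bolzano's principle: an additive property of short intervals extends to the whole interval *)
  have "P 0 t"
  proof (rule Bolzano)
    fix u v w assume "P u v" "P v w" "u \<le> v" "v \<le> w"
    then show "P u w"
      unfolding P_def by (cases "u = v"; cases "v = w") (auto simp: algebra_simps)
  next
    fix s assume s: "0 \<le> s" "s \<le> t"
    have "\<forall>\<^sub>F z in clarke_filter (x + s *\<^sub>R d).
        (case z of (y, r) \<Rightarrow> (\<phi> (y + r *\<^sub>R d) - \<phi> y) / ereal r) < ereal c"
      using less[OF s] unfolding clarke_dir_def c_def by (rule Limsup_lessD)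
    then obtain R S where R: "eventually R (nhds (x + s *\<^sub>R d))" and S: "eventually S (at_right (0::real))"
      and RS: "\<And>y r. R y \<Longrightarrow> S r \<Longrightarrow> (\<phi> (y + r *\<^sub>R d) - \<phi> y) / ereal r < ereal c"
      unfolding eventually_prod_filter by auto
    obtain e where e: "e > 0" "\<And>y. dist y (x + s *\<^sub>R d) < e \<Longrightarrow> R y"
      using R unfolding eventually_nhds_metric by blast
    obtain b where b: "b > 0" "\<And>r. 0 < r \<Longrightarrow> r < b \<Longrightarrow> S r"
      using S unfolding eventually_at_right_field by blast
    define \<delta> where "\<delta> = min b (e / (norm d + 1))"
    have "norm d + 1 > 0"
      by (simp add: add_nonneg_pos)
    then have "\<delta> > 0" using e(1) b(1) by (simp add: \<delta>_def)
    moreover have "P u v" if uv: "u \<le> s \<and> s \<le> v \<and> v - u < \<delta>" for u v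
      unfolding P_def
    proof (intro impI)
      assume uv': "0 \<le> u" "u < v" "v \<le> t"
      have "dist (x + u *\<^sub>R d) (x + s *\<^sub>R d) = (s - u) * norm d"
        using uv by (simp add: dist_norm scaleR_diff_left[symmetric])
      also have "\<dots> \<le> (v - u) * (norm d + 1)"
        using uv by (intro mult_mono) auto
      also have "\<dots> < e"
        using uv \<open>norm d + 1 > 0\<close> by (simp add: \<delta>_def field_simps)
      finally have "R (x + u *\<^sub>R d)" by (rule e(2))
      moreover have "S (v - u)"
        using uv uv' by (intro b(2)) (auto simp: \<delta>_def)
      ultimately have "(\<phi> (x + u *\<^sub>R d + (v - u) *\<^sub>R d) - \<phi> (x + u *\<^sub>R d)) / ereal (v - u) < ereal c"
        by (rule RS)
      moreover have "x + u *\<^sub>R d + (v - u) *\<^sub>R d = x + v *\<^sub>R d"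
        by (simp add: algebra_simps)
      ultimately show "\<psi> v - \<psi> u < c * (v - u)"
        using fin[of u] fin[of v] uv' by (simp add: field_simps)
    qed
    ultimately show "\<exists>\<delta>>0. \<forall>u v. u \<le> s \<and> s \<le> v \<and> v - u < \<delta> \<longrightarrow> P u v" by blast
  qed (use t in simp)
  then show False using t by (simp add: P_def c_def)
qed

section \<open>Robust constraints along a ray\<close>

lemma unif_locally_lipschitz_real:
  assumes lip: "unif_locally_lipschitz_at V h L x" and L: "L \<ge> 0"
  obtains B where "open B" "x \<in> B"
    "\<And>v. v \<in> V \<Longrightarrow> L-lipschitz_on B (\<lambda>y. real_of_ereal (h y v))"
    "\<And>y v. y \<in> B \<Longrightarrow> v \<in> V \<Longrightarrow> h y v = ereal (real_of_ereal (h y v))"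
proof -
  obtain B where B: "open B" "x \<in> B"
    and diff: "\<And>y z v. y \<in> B \<Longrightarrow> z \<in> B \<Longrightarrow> v \<in> V \<Longrightarrow> \<bar>h y v - h z v\<bar> \<le> ereal (L * norm (y - z))"
    using lip unfolding unif_locally_lipschitz_at_def by blast
  have fin: "h y v = ereal (real_of_ereal (h y v))" if "y \<in> B" "v \<in> V" for y v
    using diff[OF that(1,1,2)] by (cases "h y v") auto
  have "L-lipschitz_on B (\<lambda>y. real_of_ereal (h y v))" if v: "v \<in> V" for v
  proof (rule lipschitz_onI[OF _ L])
    fix y z assume yz: "y \<in> B" "z \<in> B"
    obtain a b where "h y v = ereal a" "h z v = ereal b"
      using fin[OF yz(1) v] fin[OF yz(2) v] by blast
    then show "dist (real_of_ereal (h y v)) (real_of_ereal (h z v)) \<le> L * dist y z"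
      using diff[OF yz v] by (simp add: dist_real_def dist_norm)
  qed
  then show ?thesis using that[OF B] fin by blast
qed

text \<open>A maximising family eventually enters the compact set of almost active indices, and upper
  semicontinuity there makes its cluster points active.\<close>

lemma maximizing_cluster_point_active:
  assumes compact: "compactin T (active_set V h \<epsilon> x)" and "\<epsilon> > 0"
    and usc: "usc_on T (active_set V h \<epsilon> x) (h x)"
    and sup: "sup_fun V h x = ereal G"
    and F: "F \<noteq> bot"
    and max: "\<And>c. c < G \<Longrightarrow> \<forall>\<^sub>F \<nu> in F. vs \<nu> \<in> V \<and> ereal c < h x (vs \<nu>)"
  obtains v F' where "F' \<le> F" "F' \<noteq> bot" "limitin T vs v F'" "v \<in> active_set V h 0 x"
proof -
  let ?K = "active_set V h \<epsilon> x"
  have "\<forall>\<^sub>F \<nu> in F. vs \<nu> \<in> ?K"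
    using max[of "G - \<epsilon>"] \<open>\<epsilon> > 0\<close> by (auto simp: active_set_def sup elim!: eventually_mono)
  from compactin_cluster_filter[OF compact F this]
  obtain v F' where v: "v \<in> ?K" "F' \<le> F" "F' \<noteq> bot" "limitin T vs v F'" .
  have inK: "\<forall>\<^sub>F \<nu> in F'. vs \<nu> \<in> ?K"
    using \<open>\<forall>\<^sub>F \<nu> in F. vs \<nu> \<in> ?K\<close> v(2) filter_leD by blast
  have lim: "limitin (subtopology T ?K) vs v F'"
    using v inK by (simp add: limitin_subtopology)
  have "ereal G \<le> h x v"
  proof (rule ccontr)
    assume "\<not> ereal G \<le> h x v"
    then obtain c where c: "h x v < ereal c" "ereal c < ereal G"
      using ereal_dense2[of "h x v" "ereal G"] by (auto simp: not_le)
    let ?W = "{w \<in> topspace (subtopology T ?K). h x w < ereal c}"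
    have "openin (subtopology T ?K) ?W"
      using usc unfolding usc_on_def by blast
    moreover have "v \<in> ?W"
      using limitin_topspace[OF lim] c(1) by blast
    ultimately have "\<forall>\<^sub>F \<nu> in F'. vs \<nu> \<in> ?W"
      by (rule limitinD[OF lim])
    moreover have "\<forall>\<^sub>F \<nu> in F'. ereal c < h x (vs \<nu>)"
      using filter_leD[OF v(2) max[of c]] c(2) by (auto elim!: eventually_mono)
    ultimately have "\<forall>\<^sub>F \<nu> in F'. False"
      by eventually_elim auto
    then show False using v(3) by (simp add: eventually_False)
  qed
  then have "v \<in> active_set V h 0 x"
    using v(1) by (simp add: active_set_def sup)
  then show ?thesis using that v by blast
qed

lemma active_set_nonempty:
  assumes compact: "compactin T (active_set V h \<epsilon> x)" and "\<epsilon> > 0"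
    and usc: "usc_on T (active_set V h \<epsilon> x) (h x)"
    and sup: "sup_fun V h x = ereal G"
  shows "active_set V h 0 x \<noteq> {}"
proof -
  have "\<forall>\<^sub>F t in at_right 0. \<exists>v. v \<in> V \<and> ereal (G - t) < h x v"
    using eventually_at_right_less[of "0::real"]
  proof eventually_elim
    case (elim t)
    then have "ereal (G - t) < (SUP v\<in>V. h x v)"
      using sup by (simp add: sup_fun_def)
    then show ?case by (auto simp: less_SUP_iff)
  qed
  then obtain vs where vs: "\<forall>\<^sub>F t in at_right 0. vs t \<in> V \<and> ereal (G - t) < h x (vs t)"
    unfolding eventually_ex by blast
  have max: "\<forall>\<^sub>F t in at_right 0. vs t \<in> V \<and> ereal c < h x (vs t)" if "c < G" for c
  proof -
    have "\<forall>\<^sub>F t in at_right 0. t < G - c"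
      using that by (auto simp: eventually_at_right_field intro!: exI[of _ "G - c"])
    with vs show ?thesis
    proof eventually_elim
      case (elim t)
      then have "ereal c < ereal (G - t)" by simp
      then show ?case using elim by (blast intro: less_trans)
    qed
  qed
  show ?thesis
    using maximizing_cluster_point_active[OF compact \<open>\<epsilon> > 0\<close> usc sup trivial_limit_at_right_real max]
    by blast
qed

lemma filterlim_ray: "((\<lambda>t. x + t *\<^sub>R d) \<longlongrightarrow> x) (at_right (0::real))"
  for x :: "'a::real_normed_vector"
  by (auto intro!: tendsto_eq_intros)

lemma eventually_segment_in_open:
  fixes x :: "'a::real_normed_vector"
  assumes "open B" "x \<in> B"
  shows "\<forall>\<^sub>F t in at_right 0. \<forall>s. 0 \<le> s \<longrightarrow> s \<le> t \<longrightarrow> x + s *\<^sub>R d \<in> B"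
proof -
  have "\<forall>\<^sub>F t in at_right 0. x + t *\<^sub>R d \<in> B"
    using topological_tendstoD[OF filterlim_ray assms] .
  then obtain b :: real where "b > 0" "\<And>t. 0 < t \<Longrightarrow> t < b \<Longrightarrow> x + t *\<^sub>R d \<in> B"
    unfolding eventually_at_right_field by blast
  moreover have "x + s *\<^sub>R d \<in> B" if "0 \<le> s" "s \<le> t" "t < b" for s t
    using calculation(2)[of s] that assms(2) by (cases "s = 0") auto
  ultimately show ?thesis
    unfolding eventually_at_right_field by blast
qed

text \<open>If the constraint failed at points \<open>x + t d\<close> with \<open>t\<close> arbitrarily small,
  say for the indices \<open>vs t\<close>, then \<open>h x (vs t) \<le> 0\<close> and the mean value theorem would produce
  subgradients \<open>\<sigma>s t\<close> at points \<open>x + ss t d\<close> of the segment with \<open>\<sigma>s t d \<ge> 0\<close>.  The uniform Lipschitz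
  constant makes the indices \<open>vs t\<close> maximising at \<open>x\<close> and the subgradients bounded, so along a finer
  filter the indices tend to an active \<open>v\<close> and the subgradients to some \<open>\<sigma>\<close>; closedness puts \<open>\<sigma>\<close> in the
  subdifferential at \<open>x\<close> for \<open>v\<close>, where \<open>\<sigma> d < 0\<close> was assumed.\<close>

proposition active_constraint_descent:
  fixes x d :: "'a::real_normed_vector"
  assumes compact: "compactin T (active_set V h \<epsilon> x)" and V: "V = topspace T" and "\<epsilon> > 0"
    and usc: "usc_on T (active_set V h \<epsilon> x) (h x)"
    and lip: "unif_locally_lipschitz_at V h L x" and L: "L \<ge> 0"
    and closed: "\<And>v. v \<in> active_set V h 0 x \<Longrightarrow>
      weak_star_closed_at T (\<lambda>y w. clarke_subdiff (\<lambda>z. h z w) y) x v"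
    and sup: "sup_fun V h x = 0"
    and neg: "\<And>v s. v \<in> active_set V h 0 x \<Longrightarrow> s \<in> clarke_subdiff (\<lambda>y. h y v) x \<Longrightarrow>
      blinfun_apply s d < 0"
  shows "\<forall>\<^sub>F t in at_right 0. \<forall>v\<in>V. h (x + t *\<^sub>R d) v \<le> 0"
proof (rule ccontr)
  assume contra: "\<not> ?thesis"
  let ?bad = "{t. \<exists>v\<in>V. 0 < h (x + t *\<^sub>R d) v}"
  define F where "F = inf (at_right (0::real)) (principal ?bad)"
  have F: "F \<noteq> bot" "F \<le> at_right 0" "\<forall>\<^sub>F t in F. t \<in> ?bad"
    using contra
    by (auto simp: F_def trivial_limit_def eventually_inf_principal not_less)
  obtain B where B: "open B" "x \<in> B"
    and lipB: "\<And>v. v \<in> V \<Longrightarrow> L-lipschitz_on B (\<lambda>y. real_of_ereal (h y v))"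
    and fin: "\<And>y v. y \<in> B \<Longrightarrow> v \<in> V \<Longrightarrow> h y v = ereal (real_of_ereal (h y v))"
    using unif_locally_lipschitz_real[OF lip L] by metis
  have nonpos: "h x v \<le> 0" if "v \<in> V" for v
    using SUP_upper[OF that, of "h x"] sup by (simp add: sup_fun_def)
  have F_pos: "\<forall>\<^sub>F t in F. 0 < t"
    using filter_leD[OF F(2) eventually_at_right_less] .
  have F_seg: "\<forall>\<^sub>F t in F. \<forall>s. 0 \<le> s \<longrightarrow> s \<le> t \<longrightarrow> x + s *\<^sub>R d \<in> B"
    using filter_leD[OF F(2) eventually_segment_in_open[OF B]] .
  have "\<forall>\<^sub>F t in F. \<exists>z. case z of (v, s, \<sigma>) \<Rightarrow> v \<in> V \<and> - (L * t * norm d) < real_of_ereal (h x v) \<and>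
      0 \<le> s \<and> s \<le> t \<and> \<sigma> \<in> clarke_subdiff (\<lambda>y. h y v) (x + s *\<^sub>R d) \<and> 0 \<le> blinfun_apply \<sigma> d \<and>
      (\<forall>e. \<bar>blinfun_apply \<sigma> e\<bar> \<le> L * norm e)"
    using F(3) F_pos F_seg
  proof eventually_elim
    case (elim t)
    obtain v where v: "v \<in> V" "0 < h (x + t *\<^sub>R d) v" using elim(1) by blast
    let ?\<psi> = "\<lambda>s. real_of_ereal (h (x + s *\<^sub>R d) v)"
    have fin_seg: "h (x + s *\<^sub>R d) v = ereal (?\<psi> s)" if "0 \<le> s" "s \<le> t" for s
      using fin elim(3) v(1) that by blast
    have "?\<psi> t > 0"
      using v(2) fin_seg[of t] elim(2) by (cases "h (x + t *\<^sub>R d) v") auto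
    have "?\<psi> 0 \<le> 0"
      using nonpos[OF v(1)] by (cases "h x v") auto
    obtain s where s: "0 \<le> s" "s \<le> t"
      "ereal ((?\<psi> t - ?\<psi> 0) / t) \<le> clarke_dir (\<lambda>y. h y v) (x + s *\<^sub>R d) d"
      using clarke_mean_value[OF elim(2), of "\<lambda>y. h y v" x d ?\<psi>] fin_seg by blast
    have sB: "x + s *\<^sub>R d \<in> B" using elim(3) s by blast
    note rep = B(1) sB lipB[OF v(1)] fin[OF _ v(1)]
    obtain \<sigma> where \<sigma>: "\<sigma> \<in> clarke_subdiff (\<lambda>y. h y v) (x + s *\<^sub>R d)"
      "ereal (blinfun_apply \<sigma> d) = clarke_dir (\<lambda>y. h y v) (x + s *\<^sub>R d) d"
      using clarke_subdiff_attains[OF rep] by metis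
    have "0 \<le> (?\<psi> t - ?\<psi> 0) / t"
      using \<open>?\<psi> t > 0\<close> \<open>?\<psi> 0 \<le> 0\<close> elim(2) by (intro divide_nonneg_pos) linarith+
    also have "\<dots> \<le> blinfun_apply \<sigma> d"
      using s(3) by (simp flip: \<sigma>(2))
    finally have "0 \<le> blinfun_apply \<sigma> d" .
    moreover have "\<bar>?\<psi> t - real_of_ereal (h x v)\<bar> \<le> L * (t * norm d)"
      using lipschitz_onD[OF lipB[OF v(1)], of "x + t *\<^sub>R d" x] elim(2,3) B(2)
      by (simp add: dist_norm)
    then have "- (L * t * norm d) < real_of_ereal (h x v)"
      using \<open>?\<psi> t > 0\<close> by (simp add: mult.assoc)
    ultimately show ?case
      using v(1) s(1,2) \<sigma>(1) clarke_subdiff_bounded[OF rep \<sigma>(1)] by blast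
  qed
  then obtain Z where "\<forall>\<^sub>F t in F. case Z t of (v, s, \<sigma>) \<Rightarrow> v \<in> V \<and> - (L * t * norm d) < real_of_ereal (h x v) \<and>
      0 \<le> s \<and> s \<le> t \<and> \<sigma> \<in> clarke_subdiff (\<lambda>y. h y v) (x + s *\<^sub>R d) \<and> 0 \<le> blinfun_apply \<sigma> d \<and>
      (\<forall>e. \<bar>blinfun_apply \<sigma> e\<bar> \<le> L * norm e)"
    unfolding eventually_ex by blast
  then obtain vs ss \<sigma>s where pick: "\<forall>\<^sub>F t in F. vs t \<in> V \<and> - (L * t * norm d) < real_of_ereal (h x (vs t)) \<and>
      0 \<le> ss t \<and> ss t \<le> t \<and> \<sigma>s t \<in> clarke_subdiff (\<lambda>y. h y (vs t)) (x + ss t *\<^sub>R d) \<and>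
      0 \<le> blinfun_apply (\<sigma>s t) d \<and> (\<forall>e. \<bar>blinfun_apply (\<sigma>s t) e\<bar> \<le> L * norm e)"
    using that[of "\<lambda>t. fst (Z t)" "\<lambda>t. fst (snd (Z t))" "\<lambda>t. snd (snd (Z t))"]
    by (simp add: case_prod_beta)
  have F_0: "((\<lambda>t. t) \<longlongrightarrow> 0) F"
    by (rule tendsto_mono[OF F(2) tendsto_ident_at])
  have "((\<lambda>t. - (L * t * norm d)) \<longlongrightarrow> 0) F"
    using F_0 by (auto intro!: tendsto_eq_intros)
  have max: "\<forall>\<^sub>F t in F. vs t \<in> V \<and> ereal c < h x (vs t)" if "c < 0" for c
    using pick order_tendstoD(1)[OF \<open>((\<lambda>t. - (L * t * norm d)) \<longlongrightarrow> 0) F\<close> that]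
  proof eventually_elim
    case (elim t)
    then have "ereal c < ereal (real_of_ereal (h x (vs t)))" by simp
    then show ?case using elim fin[OF B(2)] by metis
  qed
  have sup0: "sup_fun V h x = ereal 0" using sup by simp
  obtain v F1 where F1: "F1 \<le> F" "F1 \<noteq> bot" "limitin T vs v F1" and v: "v \<in> active_set V h 0 x"
    by (rule maximizing_cluster_point_active[OF compact \<open>\<epsilon> > 0\<close> usc sup0 F(1) max])
  have "\<forall>\<^sub>F t in F1. \<forall>e. \<bar>blinfun_apply (\<sigma>s t) e\<bar> \<le> L * norm e"
    using filter_leD[OF F1(1) pick] by eventually_elim auto
  then obtain \<sigma> F2 where F2: "F2 \<le> F1" "F2 \<noteq> bot" "limitin weak_star \<sigma>s \<sigma> F2"
    by (rule bounded_functionals_cluster_filter[OF F1(2)])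
  have F2F: "F2 \<le> F" using F1(1) F2(1) by (rule order_trans[rotated])
  note pick2 = filter_leD[OF F2F pick]
  have "(ss \<longlongrightarrow> 0) F2"
    using pick2 by (intro tendsto_sandwich[OF _ _ tendsto_const tendsto_mono[OF F2F F_0]])
      (auto elim: eventually_mono)
  then have "((\<lambda>t. x + ss t *\<^sub>R d) \<longlongrightarrow> x) F2"
    by (auto intro!: tendsto_eq_intros)
  moreover have "limitin T vs v F2"
    using F1(3) F2(1) unfolding limitin_def by (meson filter_leD)
  moreover have "\<forall>\<^sub>F t in F2. vs t \<in> topspace T \<and>
      \<sigma>s t \<in> clarke_subdiff (\<lambda>z. h z (vs t)) (x + ss t *\<^sub>R d)"
    using pick2 by eventually_elim (simp add: V)
  ultimately have "\<sigma> \<in> clarke_subdiff (\<lambda>z. h z v) x"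
    using weak_star_closed_atD[OF closed[OF v] F2(2)] F2(3) by blast
  then have "blinfun_apply \<sigma> d < 0" using neg v by blast
  moreover have "0 \<le> blinfun_apply \<sigma> d"
  proof (rule tendsto_lowerbound[OF _ _ F2(2)])
    show "((\<lambda>t. blinfun_apply (\<sigma>s t) d) \<longlongrightarrow> blinfun_apply \<sigma> d) F2"
      using F2(3) by (simp add: limitin_weak_star_iff)
    show "\<forall>\<^sub>F t in F2. 0 \<le> blinfun_apply (\<sigma>s t) d"
      using pick2 by eventually_elim blast
  qed
  ultimately show False by simp
qed

text \<open>Here the direction is arbitrary: the uniform Lipschitz bound alone keeps the supremum negative.\<close>

lemma inactive_constraint_remains:
  fixes x d :: "'a::real_normed_vector"
  assumes lip: "unif_locally_lipschitz_at V h L x" and L: "L \<ge> 0"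
    and sup: "sup_fun V h x < 0"
  shows "\<forall>\<^sub>F t in at_right 0. \<forall>v\<in>V. h (x + t *\<^sub>R d) v \<le> 0"
proof -
  obtain B where B: "open B" "x \<in> B"
    and lipB: "\<And>v. v \<in> V \<Longrightarrow> L-lipschitz_on B (\<lambda>y. real_of_ereal (h y v))"
    and fin: "\<And>y v. y \<in> B \<Longrightarrow> v \<in> V \<Longrightarrow> h y v = ereal (real_of_ereal (h y v))"
    using unif_locally_lipschitz_real[OF lip L] by metis
  obtain c where c: "sup_fun V h x < ereal c" "c < 0"
    using ereal_dense2[OF sup] by auto
  have "((\<lambda>t. L * t * norm d) \<longlongrightarrow> 0) (at_right 0)"
    by (auto intro!: tendsto_eq_intros)
  then have "\<forall>\<^sub>F t in at_right 0. L * t * norm d < - c"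
    by (rule order_tendstoD(2)) (use c in simp)
  with eventually_at_right_less[of "0::real"] eventually_segment_in_open[OF B, of d]
  show ?thesis
  proof eventually_elim
    case (elim t)
    show ?case
    proof
      fix v assume v: "v \<in> V"
      have tB: "x + t *\<^sub>R d \<in> B" using elim by simp
      have "h x v \<le> sup_fun V h x"
        unfolding sup_fun_def using v by (rule SUP_upper)
      then have "ereal (real_of_ereal (h x v)) < ereal c"
        using c(1) by (simp flip: fin[OF B(2) v])
      then have "real_of_ereal (h x v) < c" by simp
      moreover have "\<bar>real_of_ereal (h (x + t *\<^sub>R d) v) - real_of_ereal (h x v)\<bar> \<le> L * (t * norm d)"
        using lipschitz_onD[OF lipB[OF v] tB B(2)] elim(1) by (simp add: dist_norm)
      ultimately have "real_of_ereal (h (x + t *\<^sub>R d) v) \<le> 0"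
        using elim(3) unfolding mult.assoc abs_le_iff by linarith
      then show "h (x + t *\<^sub>R d) v \<le> 0"
        by (cases "h (x + t *\<^sub>R d) v") (use fin[OF tB v] in auto)
    qed
  qed
qed

section \<open>The multiplier rule\<close>

lemma compact_convex_clarke_subdiff_translate:
  fixes f :: "'a::real_normed_vector \<Rightarrow> real"
  assumes "locally_lipschitz_at f x"
  shows "(\<lambda>s. s - u) ` clarke_subdiff (\<lambda>y. ereal (f y)) x \<noteq> {}"
    and "convex ((\<lambda>s. s - u) ` clarke_subdiff (\<lambda>y. ereal (f y)) x)"
    and "compact (blinfun_apply ` (\<lambda>s. s - u) ` clarke_subdiff (\<lambda>y. ereal (f y)) x)"
proof -
  let ?S = "clarke_subdiff (\<lambda>y. ereal (f y)) x"
  obtain B L where rep: "open B" "x \<in> B" "L-lipschitz_on B f"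
    using assms unfolding locally_lipschitz_at_def by blast
  show "(\<lambda>s. s - u) ` ?S \<noteq> {}"
    using clarke_subdiff_attains[OF rep, of "\<lambda>y. ereal (f y)"] by blast
  show "convex ((\<lambda>s. s - u) ` ?S)"
    using convex_translation_subtract[OF convex_clarke_subdiff] .
  have "compact (blinfun_apply ` ?S)"
  proof (rule compact_weak_star_closed_bounded[OF closedin_clarke_subdiff])
    show "\<bar>blinfun_apply s d\<bar> \<le> L * norm d" if "s \<in> ?S" for s d
      using clarke_subdiff_bounded[OF rep _ that] by simp
  qed
  moreover have "continuous_on (blinfun_apply ` ?S) (\<lambda>c d. c d - blinfun_apply u d)"
    by (intro continuous_on_coordinatewise_then_product continuous_on_diff continuous_on_const
        continuous_on_subset[OF continuous_on_product_coordinates subset_UNIV])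
  ultimately have "compact ((\<lambda>c d. c d - blinfun_apply u d) ` blinfun_apply ` ?S)"
    by (rule compact_continuous_image[rotated])
  also have "(\<lambda>c d. c d - blinfun_apply u d) ` blinfun_apply ` ?S = blinfun_apply ` (\<lambda>s. s - u) ` ?S"
    unfolding image_image by (intro image_cong refl) (simp add: fun_eq_iff minus_blinfun.rep_eq)
  finally show "compact (blinfun_apply ` (\<lambda>s. s - u) ` ?S)" .
qed

lemma active_hull_compact_convex:
  fixes x :: "'a::real_normed_vector"
  assumes lip: "unif_locally_lipschitz_at V h L x" and L: "L \<ge> 0"
    and active: "A \<subseteq> V" "A \<noteq> {}"
  shows "weak_star_closed_hull (\<Union>v\<in>A. clarke_subdiff (\<lambda>y. h y v) x) \<noteq> {}"
    and "compact (blinfun_apply ` weak_star_closed_hull (\<Union>v\<in>A. clarke_subdiff (\<lambda>y. h y v) x))"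
proof -
  let ?S = "\<Union>v\<in>A. clarke_subdiff (\<lambda>y. h y v) x"
  obtain B where B: "open B" "x \<in> B"
    and lipB: "\<And>v. v \<in> V \<Longrightarrow> L-lipschitz_on B (\<lambda>y. real_of_ereal (h y v))"
    and fin: "\<And>y v. y \<in> B \<Longrightarrow> v \<in> V \<Longrightarrow> h y v = ereal (real_of_ereal (h y v))"
    using unif_locally_lipschitz_real[OF lip L] by metis
  obtain v where v: "v \<in> A" using active(2) by blast
  then have vV: "v \<in> V" using active(1) by blast
  obtain s where "s \<in> clarke_subdiff (\<lambda>y. h y v) x"
    using clarke_subdiff_attains[OF B lipB[OF vV] fin[OF _ vV]] by metis
  then show "weak_star_closed_hull ?S \<noteq> {}"
    using v subset_weak_star_closed_hull[of ?S] by blast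
  have "blinfun_apply s d \<le> L * norm d" if "s \<in> ?S" for s d
    using that active(1) clarke_subdiff_bounded[OF B lipB fin, of _ s d] by (auto simp: abs_le_iff)
  then have hull: "blinfun_apply s d \<le> L * norm d" if "s \<in> weak_star_closed_hull ?S" for s d
    using weak_star_closed_hull_le[of ?S d "L * norm d" s] that by blast
  have "\<bar>blinfun_apply s d\<bar> \<le> L * norm d" if "s \<in> weak_star_closed_hull ?S" for s d
    using hull[OF that, of d] hull[OF that, of "- d"] by (simp add: abs_le_iff blinfun.minus_right)
  then show "compact (blinfun_apply ` weak_star_closed_hull ?S)"
    by (intro compact_weak_star_closed_bounded closedin_weak_star_closed_hull)
qed

text \<open>The perturbation is linear, so it shifts the directional derivative by \<open>u i d\<close>; as the derivative is
  attained by a subgradient, the hypothesis makes the shifted derivative negative.\<close>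

lemma eventually_perturbed_less:
  fixes f :: "nat \<Rightarrow> 'a::real_normed_vector \<Rightarrow> real"
  assumes lip: "locally_lipschitz_at (f i) x"
    and neg: "\<And>s. s \<in> clarke_subdiff (\<lambda>y. ereal (f i y)) x \<Longrightarrow> blinfun_apply s d < blinfun_apply (u i) d"
  shows "\<forall>\<^sub>F t in at_right 0. perturbed f u i (x + t *\<^sub>R d) < perturbed f u i x"
proof -
  obtain B L where rep: "open B" "x \<in> B" "L-lipschitz_on B (f i)"
    using lip unfolding locally_lipschitz_at_def by blast
  obtain s where s: "s \<in> clarke_subdiff (\<lambda>y. ereal (f i y)) x"
    "ereal (blinfun_apply s d) = clarke_dir (\<lambda>y. ereal (f i y)) x d"
    using clarke_subdiff_attains[OF rep, of "\<lambda>y. ereal (f i y)" d] by blast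
  have "clarke_dir (\<lambda>y. ereal (f i y)) x d < ereal (blinfun_apply (u i) d)"
    using neg[OF s(1)] by (simp flip: s(2))
  from clarke_dir_less_imp_eventually_less[OF this] show ?thesis
    by eventually_elim
      (simp add: perturbed_def blinfun.add_right blinfun.scaleR_right algebra_simps)
qed

lemma sum_mem_set_sum:
  assumes "finite I" "\<And>i. i \<in> I \<Longrightarrow> h i \<in> S i"
  shows "sum h I \<in> sum S I"
  using assms by (auto simp: set_sum_alt)

theorem corollary2:
  fixes f :: "nat \<Rightarrow> 'a::banach \<Rightarrow> real"
    and U :: "nat \<Rightarrow> ('a \<Rightarrow>\<^sub>L real) set"
    and T :: "nat \<Rightarrow> 'v topology"
    and g :: "nat \<Rightarrow> 'a \<Rightarrow> 'v \<Rightarrow> ereal"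
    and \<epsilon> L :: "nat \<Rightarrow> real"
    and xbar :: 'a
    and p q :: nat
  assumes "p \<ge> 2"
    and "\<And>i. i \<in> {1..p} \<Longrightarrow> U i \<noteq> {}"
    and "\<And>j. j \<in> {1..q} \<Longrightarrow> topspace (T j) \<noteq> {}"
    and "\<And>j. j \<in> {1..q} \<Longrightarrow> Hausdorff_space (T j)"
    and "\<And>j. j \<in> {1..q} \<Longrightarrow> proper_on (topspace (T j)) (g j)"
    and "xbar \<in> robust_feasible q T g"
    and "\<And>j. j \<in> {1..q} \<Longrightarrow> \<epsilon> j > 0"
    and "\<And>j. j \<in> {1..q} \<Longrightarrow> compactin (T j) (active_set (topspace (T j)) (g j) (\<epsilon> j) xbar)"
    and "\<And>j. j \<in> {1..q} \<Longrightarrow>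
           \<forall>\<^sub>F x in nhds xbar. usc_on (T j) (active_set (topspace (T j)) (g j) (\<epsilon> j) xbar) (g j x)"
    and "\<And>j. j \<in> {1..q} \<Longrightarrow> L j > 0"
    and "\<And>j. j \<in> {1..q} \<Longrightarrow> unif_locally_lipschitz_at (topspace (T j)) (g j) (L j) xbar"
    and "\<And>j v. j \<in> {1..q} \<Longrightarrow> v \<in> active_set (topspace (T j)) (g j) 0 xbar \<Longrightarrow>
           weak_star_closed_at (T j) (\<lambda>x w. clarke_subdiff (\<lambda>y. g j y w) x) xbar v"
    and "\<And>i. i \<in> {1..p} \<Longrightarrow> locally_lipschitz_at (f i) xbar"
    and "local_highly_robust_weakly_efficient p f U (robust_feasible q T g) xbar"
  shows "\<forall>u \<in> Pi\<^sub>E {1..p} U. \<exists>(lam :: nat \<Rightarrow> real) (mu :: nat \<Rightarrow> real).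
           (\<forall>i\<in>{1..p}. lam i \<ge> 0) \<and> (\<forall>j\<in>{1..q}. mu j \<ge> 0) \<and>
           (\<Sum>i\<in>{1..p}. lam i) + (\<Sum>j\<in>{1..q}. mu j) = 1 \<and>
           (\<Sum>i\<in>{1..p}. lam i *\<^sub>R u i) \<in>
             (\<Sum>i\<in>{1..p}. (*\<^sub>R) (lam i) ` clarke_subdiff (\<lambda>x. ereal (f i x)) xbar) +
             (\<Sum>j\<in>{1..q}. (*\<^sub>R) (mu j) ` weak_star_closed_hull
                (\<Union>v\<in>active_set (topspace (T j)) (g j) 0 xbar. clarke_subdiff (\<lambda>y. g j y v) xbar)) \<and>
           (\<forall>j\<in>{1..q}. ereal (mu j) * (SUP v\<in>topspace (T j). g j xbar v) = 0) \<and>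
           (0 \<notin> weak_star_closed_hull
                (\<Union>j\<in>{1..q}. \<Union>v\<in>active_set (topspace (T j)) (g j) 0 xbar.
                   clarke_subdiff (\<lambda>y. g j y v) xbar)
            \<longrightarrow> \<not> (\<forall>i\<in>{1..p}. lam i = 0))"
proof
  fix u assume u: "u \<in> Pi\<^sub>E {1..p} U"
  define V where "V j = topspace (T j)" for j
  define Act where "Act j = active_set (V j) (g j) 0 xbar" for j
  define Df where "Df i = clarke_subdiff (\<lambda>x. ereal (f i x)) xbar" for i
  define C where "C j = weak_star_closed_hull (\<Union>v\<in>Act j. clarke_subdiff (\<lambda>y. g j y v) xbar)" for j
  define J where "J = {j\<in>{1..q}. sup_fun (V j) (g j) xbar = 0}"
  note compact = assms(8)[folded V_def] and closed = assms(12)[folded V_def Act_def]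
    and lip = assms(11)[folded V_def]
  have L: "0 \<le> L j" if "j \<in> {1..q}" for j
    using assms(10)[OF that] by simp
  have usc: "usc_on (T j) (active_set (V j) (g j) (\<epsilon> j) xbar) (g j xbar)" if "j \<in> {1..q}" for j
    using eventually_nhds_x_imp_x[OF assms(9)[OF that]] by (simp add: V_def)
  have sup: "\<exists>G\<le>0. sup_fun (V j) (g j) xbar = ereal G" if j: "j \<in> {1..q}" for j
  proof -
    obtain v where v: "v \<in> V j" using assms(3)[OF j] unfolding V_def by blast
    obtain B where "xbar \<in> B"
      "\<And>y v. y \<in> B \<Longrightarrow> v \<in> V j \<Longrightarrow> g j y v = ereal (real_of_ereal (g j y v))"
      using unif_locally_lipschitz_real[OF lip[OF j] L[OF j]] by metis
    then have "ereal (real_of_ereal (g j xbar v)) \<le> sup_fun (V j) (g j) xbar"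
      unfolding sup_fun_def using v by (metis SUP_upper)
    moreover have "sup_fun (V j) (g j) xbar \<le> 0"
      unfolding sup_fun_def using assms(6) j by (auto simp: robust_feasible_def V_def intro: SUP_least)
    ultimately show ?thesis
      by (cases "sup_fun (V j) (g j) xbar") auto
  qed
  have Act: "Act j \<subseteq> V j" "Act j \<noteq> {}" if j: "j \<in> {1..q}" for j
  proof -
    show "Act j \<subseteq> V j" by (auto simp: Act_def active_set_def)
    show "Act j \<noteq> {}"
      using sup[OF j] active_set_nonempty[OF compact[OF j] assms(7)[OF j] usc[OF j]]
      unfolding Act_def by blast
  qed
  note C_props = active_hull_compact_convex[OF lip L Act, folded C_def]

  (* indices: Inl i for the shifted objective i, Inr j for the active constraint j *)
  define K where "K = {1..p} <+> J"
  define A where "A k = (case k of Inl i \<Rightarrow> (\<lambda>s. s - u i) ` Df i | Inr j \<Rightarrow> C j)" for k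
  have no_descent: "\<exists>k\<in>K. \<exists>s\<in>A k. 0 \<le> blinfun_apply s d" for d
  proof (rule ccontr)
    assume "\<not> ?thesis"
    (* d then improves all objectives and keeps all constraints satisfied *)
    then have neg: "blinfun_apply s d < 0" if "k \<in> K" "s \<in> A k" for k s
      using that not_le by blast
    have objectives: "\<forall>\<^sub>F t in at_right 0. perturbed f u i (xbar + t *\<^sub>R d) < perturbed f u i xbar"
      if i: "i \<in> {1..p}" for i
    proof (rule eventually_perturbed_less[of f i, OF assms(13)[OF i]])
      fix s assume "s \<in> clarke_subdiff (\<lambda>y. ereal (f i y)) xbar"
      then have "s - u i \<in> A (Inl i)" by (auto simp: A_def Df_def)
      then have "blinfun_apply (s - u i) d < 0"
        using i by (intro neg) (auto simp: K_def)
      then show "blinfun_apply s d < blinfun_apply (u i) d"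
        by (simp add: minus_blinfun.rep_eq)
    qed
    have constraints: "\<forall>\<^sub>F t in at_right 0. \<forall>v\<in>V j. g j (xbar + t *\<^sub>R d) v \<le> 0"
      if j: "j \<in> {1..q}" for j
    proof (cases "j \<in> J")
      case True
      show ?thesis
      proof (rule active_constraint_descent[OF compact[OF j] V_def assms(7)[OF j] usc[OF j]
            lip[OF j] L[OF j]])
        show "sup_fun (V j) (g j) xbar = 0" using True by (simp add: J_def)
        fix v assume v: "v \<in> active_set (V j) (g j) 0 xbar"
        then show "weak_star_closed_at (T j) (\<lambda>y w. clarke_subdiff (\<lambda>z. g j z w) y) xbar v"
          using closed[OF j] by (simp add: Act_def)
        fix s assume "s \<in> clarke_subdiff (\<lambda>y. g j y v) xbar"
        then have "s \<in> A (Inr j)"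
          using v subset_weak_star_closed_hull by (fastforce simp: A_def C_def Act_def)
        then show "blinfun_apply s d < 0"
          using True by (intro neg) (auto simp: K_def)
      qed
    next
      case False
      then have "sup_fun (V j) (g j) xbar < 0"
        using sup[OF j] j by (auto simp: J_def less_le)
      then show ?thesis
        by (rule inactive_constraint_remains[OF lip[OF j] L[OF j]])
    qed
    obtain B where B: "open B" "xbar \<in> B"
      "\<not> (\<exists>x \<in> robust_feasible q T g \<inter> B. \<forall>i\<in>{1..p}. perturbed f u i x < perturbed f u i xbar)"
      using assms(14) u unfolding local_highly_robust_weakly_efficient_def by blast
    have "\<forall>\<^sub>F t in at_right 0. \<forall>i\<in>{1..p}. perturbed f u i (xbar + t *\<^sub>R d) < perturbed f u i xbar"
      using objectives by (intro eventually_ball_finite) auto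
    moreover have "\<forall>\<^sub>F t in at_right 0. \<forall>j\<in>{1..q}. \<forall>v\<in>V j. g j (xbar + t *\<^sub>R d) v \<le> 0"
      using constraints by (intro eventually_ball_finite) auto
    moreover have "\<forall>\<^sub>F t in at_right 0. xbar + t *\<^sub>R d \<in> B"
      using topological_tendstoD[OF filterlim_ray B(1,2)] .
    ultimately have "\<forall>\<^sub>F t :: real in at_right 0. False"
    proof eventually_elim
      case (elim t)
      then have "xbar + t *\<^sub>R d \<in> robust_feasible q T g \<inter> B"
        by (simp add: robust_feasible_def V_def)
      then show False using elim(1) B(3) by blast
    qed
    then show False by simp
  qed

  have J: "J \<subseteq> {1..q}" "finite J" by (auto simp: J_def)
  then have K: "finite K" by (simp add: K_def)
  have A: "A k \<noteq> {} \<and> convex (A k) \<and> compact (blinfun_apply ` A k)" if "k \<in> K" for k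
    using that unfolding K_def
  proof (elim PlusE)
    fix i assume "k = Inl i" "i \<in> {1..p}"
    then show ?thesis
      using compact_convex_clarke_subdiff_translate[OF assms(13), of i "u i"]
      by (simp add: A_def Df_def)
  next
    fix j assume "k = Inr j" "j \<in> J"
    then show ?thesis
      using C_props[of j] J(1) convex_weak_star_closed_hull
      by (auto simp: A_def C_def)
  qed
  obtain l a where l: "\<And>k. k \<in> K \<Longrightarrow> 0 \<le> l k" "sum l K = 1"
    and a: "\<And>k. k \<in> K \<Longrightarrow> a k \<in> A k" and la: "(\<Sum>k\<in>K. l k *\<^sub>R a k) = 0"
    using Gordan_alternative_weak_star[OF K A no_descent] by blast
  note split = sum.Plus[OF finite_atLeastAtMost[of 1 p] J(2), folded K_def]
  define lam where "lam i = l (Inl i)" for i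
  (* inactive constraints receive the multiplier 0 and an arbitrary element of their hull *)
  define mu where "mu j = (if j \<in> J then l (Inr j) else 0)" for j
  define s where "s i = a (Inl i) + u i" for i
  define b where "b j = (if j \<in> J then a (Inr j) else (SOME c. c \<in> C j))" for j
  have lam: "0 \<le> lam i" if "i \<in> {1..p}" for i
    using l(1)[of "Inl i"] InlI[OF that, of J] by (simp add: lam_def K_def)
  have mu: "0 \<le> mu j" for j
    using l(1)[of "Inr j"] InrI[of j J "{1..p}"] by (simp add: mu_def K_def)
  have total: "(\<Sum>i\<in>{1..p}. lam i) + (\<Sum>j\<in>{1..q}. mu j) = 1"
    using l(2) sum.mono_neutral_right[OF _ J(1), of mu]
    by (simp add: split lam_def mu_def)
  have s: "s i \<in> Df i" if "i \<in> {1..p}" for i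
    using a[of "Inl i"] InlI[OF that, of J] by (auto simp: s_def A_def K_def)
  have b: "b j \<in> C j" if "j \<in> {1..q}" for j
  proof (cases "j \<in> J")
    case True
    then show ?thesis
      using a[of "Inr j"] InrI[of j J "{1..p}"] by (simp add: b_def A_def K_def)
  next
    case False
    then show ?thesis using C_props(1)[OF that] that by (auto simp: b_def some_in_eq)
  qed
  have "(\<Sum>j\<in>{1..q}. mu j *\<^sub>R b j) = (\<Sum>j\<in>J. l (Inr j) *\<^sub>R a (Inr j))"
    using J(1) by (intro sum.mono_neutral_cong_right) (auto simp: mu_def b_def)
  then have sum: "(\<Sum>i\<in>{1..p}. lam i *\<^sub>R u i) =
      (\<Sum>i\<in>{1..p}. lam i *\<^sub>R s i) + (\<Sum>j\<in>{1..q}. mu j *\<^sub>R b j)"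
    using la by (simp add: split lam_def s_def scaleR_add_right sum.distrib)
  have multiplier_rule: "(\<Sum>i\<in>{1..p}. lam i *\<^sub>R u i) \<in>
      (\<Sum>i\<in>{1..p}. (*\<^sub>R) (lam i) ` Df i) + (\<Sum>j\<in>{1..q}. (*\<^sub>R) (mu j) ` C j)"
    unfolding sum using s b by (intro set_plus_intro sum_mem_set_sum) auto
  have complementary: "ereal (mu j) * (SUP v\<in>V j. g j xbar v) = 0" for j
    by (auto simp: mu_def J_def sup_fun_def)
  have qualification: "\<not> (\<forall>i\<in>{1..p}. lam i = 0)"
    if "0 \<notin> weak_star_closed_hull (\<Union>j\<in>{1..q}. \<Union>v\<in>Act j. clarke_subdiff (\<lambda>y. g j y v) xbar)"
    (is "0 \<notin> ?H")
  proof
    assume zero: "\<forall>i\<in>{1..p}. lam i = 0"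
    have "b j \<in> ?H" if "j \<in> {1..q}" for j
      using b[OF that] weak_star_closed_hull_mono[of _ "\<Union>j\<in>{1..q}. \<Union>v\<in>Act j. clarke_subdiff (\<lambda>y. g j y v) xbar"] that
      unfolding C_def by (meson UN_upper subsetD)
    moreover have "(\<Sum>j\<in>{1..q}. mu j) = 1" using total zero by simp
    ultimately have "(\<Sum>j\<in>{1..q}. mu j *\<^sub>R b j) \<in> ?H"
      using mu by (intro convex_sum convex_weak_star_closed_hull) auto
    then show False using that sum zero by simp
  qed
  show "\<exists>lam mu. (\<forall>i\<in>{1..p}. lam i \<ge> 0) \<and> (\<forall>j\<in>{1..q}. mu j \<ge> 0) \<and>
           (\<Sum>i\<in>{1..p}. lam i) + (\<Sum>j\<in>{1..q}. mu j) = 1 \<and>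
           (\<Sum>i\<in>{1..p}. lam i *\<^sub>R u i) \<in>
             (\<Sum>i\<in>{1..p}. (*\<^sub>R) (lam i) ` clarke_subdiff (\<lambda>x. ereal (f i x)) xbar) +
             (\<Sum>j\<in>{1..q}. (*\<^sub>R) (mu j) ` weak_star_closed_hull
                (\<Union>v\<in>active_set (topspace (T j)) (g j) 0 xbar. clarke_subdiff (\<lambda>y. g j y v) xbar)) \<and>
           (\<forall>j\<in>{1..q}. ereal (mu j) * (SUP v\<in>topspace (T j). g j xbar v) = 0) \<and>
           (0 \<notin> weak_star_closed_hull
                (\<Union>j\<in>{1..q}. \<Union>v\<in>active_set (topspace (T j)) (g j) 0 xbar.
                   clarke_subdiff (\<lambda>y. g j y v) xbar)
            \<longrightarrow> \<not> (\<forall>i\<in>{1..p}. lam i = 0))"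
    unfolding V_def[symmetric] Act_def[symmetric] Df_def[symmetric] C_def[symmetric]
    using lam mu total multiplier_rule complementary qualification by blast
qed

end
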